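(* Consider the system of the isotropic SU(3) magnet over a generic orbit in the $N$-gap phase space $\mathcal M$, with the Lie-Poisson bracket $\{\cdot,\cdot\}$ (all defined in the context). Let the variables of separation $\{(\lambda_k,w_k): k=1,\dots,3N\}$ be defined by $$\mathcal{B}(\lambda_k)=0,\qquad w_k=\mathcal{A}(\lambda_k),$$ where $\mathcal B$ is the polynomial of degree $3N$ $$\mathcal{B}(\lambda)= \big[L_{11}(\lambda) - L_{22}(\lambda) \big] L_{31}(\lambda)L_{32}(\lambda)- L_{12}(\lambda) L_{31}^2(\lambda) + L_{21}(\lambda) L_{32}^2(\lambda)$$ and $$\mathcal{A}(\lambda_k) = L_{11}(\lambda_k) -\frac{L_{12}(\lambda_k) L_{31}(\lambda_k)}{L_{32}(\lambda_k)} = L_{22}(\lambda_k) - \frac{L_{21}(\lambda_k) L_{32}(\lambda_k)}{L_{31}(\lambda_k)}.$$ The variables of separation have the following properties: (1) a pair $(w_k,\lambda_k)$ is a point of the spectral curve $$w^3-w\,I_2(\lambda)-I_3(\lambda)=0,\qquad I_2(\lambda)=\tfrac12\operatorname{Tr}\hat L^2(\lambda),\quad I_3(\lambda)=\tfrac13\operatorname{Tr}\hat L^3(\lambda);$$ (2) a pair $(w_k,\lambda_k)$ is quasi-canonically conjugate with respect to the Lie-Poisson bracket: $$\{\lambda_k,\lambda_l\}=0,\qquad \{\lambda_k,w_l\}=-\lambda_k^{N}\delta_{kl},\qquad \{w_k,w_l\}=0;$$ (3) the corresponding Liouville 1-form is $$\Omega=-\sum_{k}\lambda_k^{-N}w_k\,d\lambda_k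 .$$
   Context: Phase space. $\mathcal M$ consists of matrix polynomials $\hat L(\lambda)=\sum_{p=0}^{N}\hat L^{(p)}\lambda^p$ whose coefficients are traceless Hermitian $3\times3$ matrices (elements of $\mathrm{i}\,\mathfrak{su}(3)$) with fixed leading coefficient $\hat L^{(N)}=\frac12\operatorname{diag}(m+q,\,-m+q,\,-2q)$, where $m,q$ are constants. For the separation of variables $\hat L$ is replaced by $\hat R^{-1}\hat L\hat R$ (again denoted $\hat L$, with entries $L_{ij}(\lambda)=\sum_{p=0}^N L_{ij}^{(p)}\lambda^p$), where $$\hat R=\begin{pmatrix}\frac1{\sqrt2}&\frac12&\frac12\\-\frac1{\sqrt2}&\frac12&\frac12\\0&-\frac1{\sqrt2}&\frac1{\sqrt2}\end{pmatrix},\qquad \hat R^{-1}\hat L^{(N)}\hat R=\frac12\begin{pmatrix} q & \frac{m}{\sqrt2} & \frac{m}{\sqrt2}\\ \frac{m}{\sqrt2} & -\frac q2 & \frac{3q}{2}\\ \frac{m}{\sqrt2}&\frac{3q}{2}&-\frac q2\end{pmatrix};$$ this is done so that $\mathcal B$ attains its maximal degree $3N$. The dynamic variables are the $L_{ij}^{(p)}$, $p=0,\dots,N-1$, with $L_{11}^{(p)}+L_{22}^{(p)}+L_{33}^{(p)}=0$. Poisson bracket. The Lie-Poisson bracket on $\mathcal M$ is given by $$\{L_{ij}^{(r)},L_{kl}^{(s)}\}=L_{kj}^{(r+s+1-N)}\delta_{il}-L_{il}^{(r+s+1-N)}\delta_{kj},\qquad 0\le r,s\le N-1,$$ where $L_{ij}^{(p)}=0$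 for $p<0$. Orbits. Write $I_2(\lambda)=\sum_{k=0}^{2N}h_k\lambda^k$ and $I_3(\lambda)=\sum_{k=0}^{3N}f_k\lambda^k$. The functions $h_0,\dots,h_{N-1},f_0,\dots,f_{N-1}$ annihilate the bracket, and a generic orbit, of dimension $6N$, is defined by fixing their values: $h_j=c_j$, $f_j=b_j$, $j=0,\dots,N-1$. The spectral curve is $\det(\hat L(\lambda)-w\mathbb I)=0$, where $\mathbb I$ is the $3\times3$ identity matrix. *)

theory Defs
  imports "HOL-Analysis.Analysis" "HOL-Computational_Algebra.Polynomial"
begin

text \<open>
  The number \<open>N\<close> of gaps is \<open>CARD('n)\<close> for an arbitrary (nonempty) finite enumerated index type
  \<open>'n\<close>; every \<open>N \<ge> 1\<close> occurs, e.g. for the numeral types.  A point \<open>L\<close> of the phase space is the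
  tuple of its dynamic coefficients of degrees \<open>0, \<dots>, N - 1\<close>, the coefficient of degree \<open>p\<close> being
  the one at the \<open>p\<close>-th index in the enumeration of \<open>'n\<close>.  Throughout, \<open>L\<close> is the matrix
  polynomial already conjugated by \<open>R\<close>; \<open>R\<close> is real orthogonal, so the coefficients stay Hermitian
  and traceless.
\<close>

definition phase_space :: "(complex^3^3^'n::enum) set" where
  "phase_space = {L. \<forall>p. trace (L $ p) = 0 \<and> (\<forall>i j. L $ p $ i $ j = cnj (L $ p $ j $ i))}"

definition Lcoef :: "complex^3^3^'n::enum \<Rightarrow> nat \<Rightarrow> complex^3^3" where
  "Lcoef L p = L $ (Enum.enum ! p)"

definition Rmat :: "complex^3^3" where
  "Rmat = vector
     [vector [  complex_of_real (1 / sqrt 2), 1 / 2, 1 / 2],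
      vector [- complex_of_real (1 / sqrt 2), 1 / 2, 1 / 2],
      vector [0, - complex_of_real (1 / sqrt 2), complex_of_real (1 / sqrt 2)]]"

definition lead_diag :: "real \<Rightarrow> real \<Rightarrow> complex^3^3" where
  "lead_diag m q = vector
     [vector [complex_of_real ((m + q) / 2), 0, 0],
      vector [0, complex_of_real ((- m + q) / 2), 0],
      vector [0, 0, complex_of_real (- q)]]"

definition lead_coef :: "real \<Rightarrow> real \<Rightarrow> complex^3^3" where
  "lead_coef m q = matrix_inv Rmat ** lead_diag m q ** Rmat"

lemma lead_coef_eq:
  "lead_coef m q = vector
     [vector [complex_of_real (q / 2), complex_of_real (m / (2 * sqrt 2)),
              complex_of_real (m / (2 * sqrt 2))],
      vector [complex_of_real (m / (2 * sqrt 2)), complex_of_real (- q / 4),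
              complex_of_real (3 * q / 4)],
      vector [complex_of_real (m / (2 * sqrt 2)), complex_of_real (3 * q / 4),
              complex_of_real (- q / 4)]]"
proof -
  have s: "complex_of_real (sqrt 2) * complex_of_real (sqrt 2) = 2"
    by (metis abs_numeral of_real_mult of_real_numeral real_sqrt_mult_self)
  have s0: "complex_of_real (sqrt 2) \<noteq> 0" by simp
  have 1: "transpose Rmat ** Rmat = mat 1" "Rmat ** transpose Rmat = mat 1"
    by (simp_all add: vec_eq_iff forall_3 Rmat_def matrix_matrix_mult_def transpose_def mat_def sum_3
        vector_3 s s0 field_simps)
  then have "invertible Rmat" unfolding invertible_def by blast
  then have "Rmat ** matrix_inv Rmat = mat 1"
    unfolding matrix_inv_def invertible_def by (rule someI2_ex) simp
  then have inv: "matrix_inv Rmat = transpose Rmat"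
    using 1 by (metis matrix_mul_assoc matrix_mul_lid matrix_mul_rid)
  show ?thesis
    unfolding lead_coef_def inv
    by (simp add: vec_eq_iff forall_3 Rmat_def lead_diag_def matrix_matrix_mult_def
        transpose_def sum_3 vector_3 s s0 field_simps)
qed

definition Lpoly :: "real \<Rightarrow> real \<Rightarrow> complex^3^3^'n::enum \<Rightarrow> complex poly^3^3" where
  "Lpoly m q L = (\<chi> i j. (\<Sum>p<CARD('n). monom (Lcoef L p $ i $ j) p)
                          + monom (lead_coef m q $ i $ j) CARD('n))"

definition Leval :: "real \<Rightarrow> real \<Rightarrow> complex^3^3^'n::enum \<Rightarrow> complex \<Rightarrow> complex^3^3" where
  "Leval m q L z = (\<chi> i j. poly (Lpoly m q L $ i $ j) z)"

definition I2 :: "real \<Rightarrow> real \<Rightarrow> complex^3^3^'n::enum \<Rightarrow> complex poly" where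
  "I2 m q L = smult (1 / 2) (trace (Lpoly m q L ** Lpoly m q L))"

definition I3 :: "real \<Rightarrow> real \<Rightarrow> complex^3^3^'n::enum \<Rightarrow> complex poly" where
  "I3 m q L = smult (1 / 3) (trace (Lpoly m q L ** Lpoly m q L ** Lpoly m q L))"

definition spectral_curve :: "real \<Rightarrow> real \<Rightarrow> complex^3^3^'n::enum \<Rightarrow> (complex \<times> complex) set" where
  "spectral_curve m q L = {(w, z). det (Leval m q L z - mat w) = 0}"

definition Bpoly :: "real \<Rightarrow> real \<Rightarrow> complex^3^3^'n::enum \<Rightarrow> complex poly" where
  "Bpoly m q L = (let P = Lpoly m q L in
     (P $ 1 $ 1 - P $ 2 $ 2) * P $ 3 $ 1 * P $ 3 $ 2
     - P $ 1 $ 2 * (P $ 3 $ 1)\<^sup>2 + P $ 2 $ 1 * (P $ 3 $ 2)\<^sup>2)"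

definition Afun :: "real \<Rightarrow> real \<Rightarrow> complex^3^3^'n::enum \<Rightarrow> complex \<Rightarrow> complex" where
  "Afun m q L z = (let E = Leval m q L z in E $ 1 $ 1 - E $ 1 $ 2 * E $ 3 $ 1 / E $ 3 $ 2)"

definition Afun' :: "real \<Rightarrow> real \<Rightarrow> complex^3^3^'n::enum \<Rightarrow> complex \<Rightarrow> complex" where
  "Afun' m q L z = (let E = Leval m q L z in E $ 2 $ 2 - E $ 2 $ 1 * E $ 3 $ 2 / E $ 3 $ 1)"


section \<open>The Lie-Poisson bracket\<close>

text \<open>The value at \<open>L\<close> of the bracket of the coordinates \<open>L_ij^(r)\<close> and \<open>L_kl^(s)\<close>.\<close>

definition coord_bracket ::
  "complex^3^3^'n::enum \<Rightarrow> nat \<Rightarrow> 3 \<Rightarrow> 3 \<Rightarrow> nat \<Rightarrow> 3 \<Rightarrow> 3 \<Rightarrow> complex" where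
  "coord_bracket L r i j s k l =
     (if r + s + 1 < CARD('n) then 0
      else (if i = l then Lcoef L (r + s + 1 - CARD('n)) $ k $ j else 0)
         - (if k = j then Lcoef L (r + s + 1 - CARD('n)) $ i $ l else 0))"

text \<open>
  A covector is given by coefficients \<open>a r i j\<close> and stands for the sum of the
  \<open>a r i j dL_ij^(r)\<close>.  Complex-valued functions on the phase space are differentiated along the
  phase space, where the coordinates satisfy \<open>L_11 + L_22 + L_33 = 0\<close>; so the coefficients of a
  differential are unique only up to multiples of the identity matrix for each \<open>r\<close>.  These do not
  affect the bracket (see \<open>bivector_cong\<close> below).
\<close>

definition covector :: "(nat \<Rightarrow> 3 \<Rightarrow> 3 \<Rightarrow> complex) \<Rightarrow> complex^3^3^'n::enum \<Rightarrow> complex" where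
  "covector a V = (\<Sum>r<CARD('n). \<Sum>i\<in>UNIV. \<Sum>j\<in>UNIV. a r i j * Lcoef V r $ i $ j)"

definition has_differential ::
  "(complex^3^3^'n::enum \<Rightarrow> complex) \<Rightarrow> (nat \<Rightarrow> 3 \<Rightarrow> 3 \<Rightarrow> complex) \<Rightarrow> complex^3^3^'n::enum \<Rightarrow> bool" where
  "has_differential f a L \<longleftrightarrow> (f has_derivative covector a) (at L within phase_space)"

definition bivector ::
  "complex^3^3^'n::enum \<Rightarrow> (nat \<Rightarrow> 3 \<Rightarrow> 3 \<Rightarrow> complex) \<Rightarrow> (nat \<Rightarrow> 3 \<Rightarrow> 3 \<Rightarrow> complex) \<Rightarrow> complex" where
  "bivector L a b =
     (\<Sum>r<CARD('n). \<Sum>i\<in>UNIV. \<Sum>j\<in>UNIV. \<Sum>s<CARD('n). \<Sum>k\<in>UNIV. \<Sum>l\<in>UNIV.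
        a r i j * b s k l * coord_bracket L r i j s k l)"

definition poisson ::
  "(complex^3^3^'n::enum \<Rightarrow> complex) \<Rightarrow> (complex^3^3^'n::enum \<Rightarrow> complex) \<Rightarrow> complex^3^3^'n::enum \<Rightarrow> complex" where
  "poisson f g L =
     bivector L (SOME a. has_differential f a L) (SOME b. has_differential g b L)"


text \<open>
  The bracket does not depend on the choice of the coefficients of the differentials, and it takes
  the prescribed values on the coordinates.
\<close>

lemma bivector_antisym: "bivector (L :: complex^3^3^'n::enum) a b = - bivector L b a"
proof -
  have c: "coord_bracket L r i j s k l = - coord_bracket L s k l r i j" for r i j s k l
    by (simp add: coord_bracket_def add.commute)
  let ?A = "{..<CARD('n)} \<times> (UNIV::3 set) \<times> (UNIV::3 set)"
  have b: "bivector L a b = (\<Sum>x\<in>?A. \<Sum>y\<in>?A. case x of (r, i, j) \<Rightarrow> case y of (s, k, l) \<Rightarrow>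
      a r i j * b s k l * coord_bracket L r i j s k l)" for a b
  proof -
    have "bivector L a b = (\<Sum>(r, i, j)\<in>?A. \<Sum>(s, k, l)\<in>?A.
        a r i j * b s k l * coord_bracket L r i j s k l)"
      unfolding bivector_def sum.cartesian_product[symmetric] ..
    then show ?thesis by (simp add: split_def)
  qed
  have "bivector L a b = (\<Sum>y\<in>?A. \<Sum>x\<in>?A. case x of (r, i, j) \<Rightarrow> case y of (s, k, l) \<Rightarrow>
      a r i j * b s k l * coord_bracket L r i j s k l)"
    unfolding b by (rule sum.swap)
  also have "\<dots> = (\<Sum>y\<in>?A. \<Sum>x\<in>?A. - (case y of (s, k, l) \<Rightarrow> case x of (r, i, j) \<Rightarrow>
      b s k l * a r i j * coord_bracket L s k l r i j))"
  proof (intro sum.cong refl)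
    fix x y :: "nat \<times> 3 \<times> 3"
    obtain r i j s k l where "x = (r, i, j)" "y = (s, k, l)" by (metis prod_cases3)
    then show "(case x of (r, i, j) \<Rightarrow> case y of (s, k, l) \<Rightarrow>
        a r i j * b s k l * coord_bracket L r i j s k l)
      = - (case y of (s, k, l) \<Rightarrow> case x of (r, i, j) \<Rightarrow>
        b s k l * a r i j * coord_bracket L s k l r i j)"
      using c[of r i j s k l] by simp
  qed
  also have "\<dots> = - bivector L b a"
    unfolding b by (simp add: sum_negf)
  finally show ?thesis .
qed

lemma Lcoef_single:
  assumes "r < CARD('n)" "s < CARD('n)"
  shows "Lcoef ((\<chi> p. if p = Enum.enum ! r then X else 0) :: complex^3^3^'n::enum) s
           = (if s = r then X else 0)"
proof -
  have "length (Enum.enum :: 'n list) = CARD('n)"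
    by (metis UNIV_enum distinct_card enum_distinct)
  then show ?thesis
    using assms by (simp add: Lcoef_def nth_eq_iff_index_eq enum_distinct)
qed

lemma covector_single:
  assumes "r < CARD('n)"
  shows "covector a ((\<chi> p. if p = Enum.enum ! r then X else 0) :: complex^3^3^'n::enum)
           = (\<Sum>i\<in>UNIV. \<Sum>j\<in>UNIV. a r i j * X $ i $ j)"
proof -
  have "covector a ((\<chi> p. if p = Enum.enum ! r then X else 0) :: complex^3^3^'n::enum)
      = (\<Sum>s<CARD('n). if s = r then (\<Sum>i\<in>UNIV. \<Sum>j\<in>UNIV. a r i j * X $ i $ j) else 0)"
    unfolding covector_def using assms by (intro sum.cong refl) (auto simp: Lcoef_single)
  then show ?thesis using assms by simp
qed

lemma single_in_phase_space:
  assumes "trace X = 0" "\<And>i j. X $ i $ j = cnj (X $ j $ i)"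
  shows "((\<chi> p. if p = Enum.enum ! r then X else 0) :: complex^3^3^'n::enum) \<in> phase_space"
  unfolding phase_space_def mem_Collect_eq
proof (intro allI conjI)
  fix p :: 'n and i j
  show "trace ((\<chi> p. if p = Enum.enum ! r then X else 0) $ p) = 0"
    using assms(1) by (simp add: trace_def)
  show "(\<chi> p. if p = Enum.enum ! r then X else 0) $ p $ i $ j
      = cnj ((\<chi> p. if p = Enum.enum ! r then X else 0) $ p $ j $ i)"
    using assms(2)[of i j] by simp
qed

lemma covector_zero_imp_scalar:
  assumes z: "\<forall>V\<in>phase_space. covector a (V :: complex^3^3^'n::enum) = 0" and r: "r < CARD('n)"
  shows "a r i j = (if i = j then a r 1 1 else 0)"
proof -
  have *: "(\<Sum>i\<in>UNIV. \<Sum>j\<in>UNIV. a r i j * X $ i $ j) = 0"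
    if "trace X = 0" "\<And>i j. X $ i $ j = cnj (X $ j $ i)" for X :: "complex^3^3"
    using bspec[OF z single_in_phase_space[OF that, of r]] covector_single[OF r, of a X] by simp
  have off: "a r i j = 0" if "i \<noteq> j"
  proof -
    let ?X = "(\<chi> k l. if k = i \<and> l = j \<or> k = j \<and> l = i then 1 else 0) :: complex^3^3"
    let ?Y = "(\<chi> k l. if k = i \<and> l = j then \<i> else if k = j \<and> l = i then - \<i> else 0)
                :: complex^3^3"
    have X: "(\<Sum>i\<in>UNIV. \<Sum>j\<in>UNIV. a r i j * ?X $ i $ j) = 0"
      by (rule *) (use that in \<open>auto simp: trace_def intro!: sum.neutral\<close>)
    have Y: "(\<Sum>i\<in>UNIV. \<Sum>j\<in>UNIV. a r i j * ?Y $ i $ j) = 0"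
      by (rule *) (use that in \<open>auto simp: trace_def intro!: sum.neutral\<close>)
    have ij: "i = 1 \<or> i = 2 \<or> i = 3" "j = 1 \<or> j = 2 \<or> j = 3" using exhaust_3 by auto
    have "a r i j + a r j i = 0"
      using ij that X by (elim disjE) (simp_all add: sum_3 add.commute)
    moreover have "\<i> * (a r i j - a r j i) = 0"
      using ij that Y by (elim disjE) (simp_all add: sum_3 mult.commute)
    ultimately show ?thesis by (simp add: add_eq_0_iff)
  qed
  have dia: "a r i i = a r 1 1"
  proof (cases "i = 1")
    case False
    let ?Z = "(\<chi> k l. if k = l \<and> k = i then 1 else if k = l \<and> k = 1 then - 1 else 0) :: complex^3^3"
    have "i = 2 \<or> i = 3" using False exhaust_3 by auto
    moreover have "(\<Sum>i\<in>UNIV. \<Sum>j\<in>UNIV. a r i j * ?Z $ i $ j) = 0"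
      by (rule *) (use False \<open>i = 2 \<or> i = 3\<close> in \<open>auto simp: trace_def sum_3\<close>)
    ultimately show ?thesis by (auto simp: sum_3)
  qed simp
  show ?thesis using off dia by auto
qed

lemma bivector_scalar:
  assumes "\<And>r i j. r < CARD('n) \<Longrightarrow> a r i j = (if i = j then t r else 0)"
  shows "bivector (L :: complex^3^3^'n::enum) a b = 0"
proof -
  have c: "(\<Sum>i\<in>UNIV. coord_bracket L r i i s k l) = 0" for r s k l
    by (cases "r + s + 1 < CARD('n)") (simp_all add: coord_bracket_def sum_subtractf)
  have sw: "(\<Sum>i\<in>UNIV. \<Sum>s<CARD('n). \<Sum>k\<in>UNIV. \<Sum>l\<in>UNIV. F i s k l)
      = (\<Sum>s<CARD('n). \<Sum>k\<in>UNIV. \<Sum>l\<in>UNIV. \<Sum>i\<in>UNIV. F i s k l)"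
    for F :: "3 \<Rightarrow> nat \<Rightarrow> 3 \<Rightarrow> 3 \<Rightarrow> complex"
    by (subst sum.swap, rule sum.cong[OF refl], subst sum.swap, rule sum.cong[OF refl],
        rule sum.swap)
  have "bivector L a b = (\<Sum>r<CARD('n). \<Sum>i\<in>UNIV. \<Sum>s<CARD('n). \<Sum>k\<in>UNIV. \<Sum>l\<in>UNIV.
          t r * b s k l * coord_bracket L r i i s k l)"
    unfolding bivector_def
  proof (intro sum.cong refl)
    fix r i assume "r \<in> {..<CARD('n)}"
    then have "(\<Sum>j\<in>UNIV. \<Sum>s<CARD('n). \<Sum>k\<in>UNIV. \<Sum>l\<in>UNIV.
        a r i j * b s k l * coord_bracket L r i j s k l)
      = (\<Sum>j\<in>UNIV. if i = j then \<Sum>s<CARD('n). \<Sum>k\<in>UNIV. \<Sum>l\<in>UNIV.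
        t r * b s k l * coord_bracket L r i i s k l else 0)"
      by (intro sum.cong refl) (auto simp: assms)
    then show "(\<Sum>j\<in>UNIV. \<Sum>s<CARD('n). \<Sum>k\<in>UNIV. \<Sum>l\<in>UNIV.
        a r i j * b s k l * coord_bracket L r i j s k l)
      = (\<Sum>s<CARD('n). \<Sum>k\<in>UNIV. \<Sum>l\<in>UNIV. t r * b s k l * coord_bracket L r i i s k l)"
      by simp
  qed
  also have "\<dots> = (\<Sum>r<CARD('n). \<Sum>s<CARD('n). \<Sum>k\<in>UNIV. \<Sum>l\<in>UNIV. \<Sum>i\<in>UNIV.
          t r * b s k l * coord_bracket L r i i s k l)"
    by (rule sum.cong[OF refl], rule sw)
  also have "\<dots> = 0"
    by (simp add: sum_distrib_left[symmetric] c)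
  finally show ?thesis .
qed

lemma bivector_cong_left:
  assumes "\<forall>V\<in>phase_space. covector a (V :: complex^3^3^'n::enum) = covector a' V"
  shows "bivector (L :: complex^3^3^'n::enum) a b = bivector L a' b"
proof -
  let ?d = "\<lambda>r i j. a r i j - a' r i j"
  have "covector ?d V = covector a V - covector a' V" for V :: "complex^3^3^'n::enum"
    by (simp add: covector_def sum_subtractf algebra_simps)
  then have "\<forall>V\<in>phase_space. covector ?d (V :: complex^3^3^'n::enum) = 0" using assms by simp
  then have "?d r i j = (if i = j then ?d r 1 1 else 0)" if "r < CARD('n)" for r i j
    using covector_zero_imp_scalar[of ?d r i j] that by blast
  then have "bivector L ?d b = 0" by (intro bivector_scalar) blast
  moreover have "bivector L ?d b = bivector L a b - bivector L a' b"
    by (simp add: bivector_def sum_subtractf left_diff_distrib)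
  ultimately show ?thesis by simp
qed

lemma bivector_cong:
  assumes "\<forall>V\<in>phase_space. covector a (V :: complex^3^3^'n::enum) = covector a' V"
    and "\<forall>V\<in>phase_space. covector b (V :: complex^3^3^'n::enum) = covector b' V"
  shows "bivector (L :: complex^3^3^'n::enum) a b = bivector L a' b'"
  using bivector_cong_left[OF assms(1)] bivector_cong_left[OF assms(2)] bivector_antisym
  by metis

lemma phase_space_affine:
  assumes "(L :: complex^3^3^'n::enum) \<in> phase_space" "V \<in> phase_space"
  shows "L + t *\<^sub>R V \<in> phase_space"
proof -
  have L: "trace (L $ p) = 0" "L $ p $ i $ j = cnj (L $ p $ j $ i)"
    and V: "trace (V $ p) = 0" "V $ p $ i $ j = cnj (V $ p $ j $ i)" for p i j
    using assms unfolding phase_space_def by blast+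
  show ?thesis
    unfolding phase_space_def mem_Collect_eq
  proof (intro allI conjI)
    fix p i j
    have "trace ((L + t *\<^sub>R V) $ p) = trace (L $ p) + t *\<^sub>R trace (V $ p)"
      by (simp add: trace_def sum.distrib scaleR_sum_right)
    then show "trace ((L + t *\<^sub>R V) $ p) = 0"
      by (simp add: L(1) V(1))
    show "(L + t *\<^sub>R V) $ p $ i $ j = cnj ((L + t *\<^sub>R V) $ p $ j $ i)"
      using L(2)[of p i j] V(2)[of p i j] by simp
  qed
qed

lemma has_differential_unique:
  assumes "has_differential f a L" "has_differential f a' L"
    and "(L :: complex^3^3^'n::enum) \<in> phase_space" "(V :: complex^3^3^'n::enum) \<in> phase_space"
  shows "covector a V = covector a' V"
proof -
  have D: "((\<lambda>t. f (L + t *\<^sub>R V)) has_derivative (\<lambda>t. covector a (t *\<^sub>R V))) (at (0::real))"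
    if "has_differential f a L" for a
  proof -
    have "((\<lambda>t. L + t *\<^sub>R V) has_derivative (\<lambda>t. t *\<^sub>R V)) (at (0::real))"
      by (auto intro!: derivative_eq_intros)
    moreover have "(f has_derivative covector a)
        (at (L + 0 *\<^sub>R V) within range (\<lambda>t. L + t *\<^sub>R V))"
    proof -
      have "range (\<lambda>t. L + t *\<^sub>R V) \<subseteq> phase_space"
        using phase_space_affine[OF assms(3,4)] by blast
      from has_derivative_subset[OF that[unfolded has_differential_def] this]
      show ?thesis by simp
    qed
    ultimately show ?thesis
      using has_derivative_in_compose[of "\<lambda>t. L + t *\<^sub>R V" "\<lambda>t. t *\<^sub>R V" 0 UNIV f "covector a"]
      by simp
  qed
  have "(\<lambda>t::real. covector a (t *\<^sub>R V)) = (\<lambda>t. covector a' (t *\<^sub>R V))"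
    by (rule has_derivative_unique[OF D[OF assms(1)] D[OF assms(2)]])
  from fun_cong[OF this, of 1] show ?thesis by simp
qed

lemma poisson_eq_bivector:
  assumes "has_differential f a L" "has_differential g b L"
    and "(L :: complex^3^3^'n::enum) \<in> phase_space"
  shows "poisson f g L = bivector L a b"
  unfolding poisson_def
proof (rule bivector_cong)
  have h1: "has_differential f (SOME a. has_differential f a L) L"
    by (rule someI[of "\<lambda>a. has_differential f a L", OF assms(1)])
  show "\<forall>V\<in>phase_space :: (complex^3^3^'n::enum) set.
      covector (SOME a. has_differential f a L) V = covector a V"
    by (intro ballI has_differential_unique[OF h1 assms(1,3)])
  have h2: "has_differential g (SOME b. has_differential g b L) L"
    by (rule someI[of "\<lambda>b. has_differential g b L", OF assms(2)])
  show "\<forall>V\<in>phase_space :: (complex^3^3^'n::enum) set.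
      covector (SOME b. has_differential g b L) V = covector b V"
    by (intro ballI has_differential_unique[OF h2 assms(2,3)])
qed

lemma poisson_coordinates:
  assumes "r < CARD('n)" "s < CARD('n)" "(L :: complex^3^3^'n::enum) \<in> phase_space"
  shows "poisson (\<lambda>L. Lcoef L r $ i $ j) (\<lambda>L. Lcoef L s $ k $ l) L = coord_bracket L r i j s k l"
proof -
  let ?e = "\<lambda>r i j r' i' j'. if j' = j then if i' = i then if r' = r then 1 else 0 else 0 else 0"
  have c: "covector (?e r i j) V = Lcoef V r $ i $ j" if "r < CARD('n)"
    for r i j and V :: "complex^3^3^'n::enum"
    using that by (simp add: covector_def if_distrib[of "\<lambda>x. x * _"] cong: if_cong)
  have "has_differential (\<lambda>L. Lcoef L r $ i $ j) (?e r i j) L" if "r < CARD('n)" for r i j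
  proof -
    have "bounded_linear (\<lambda>L :: complex^3^3^'n::enum. Lcoef L r $ i $ j)"
      unfolding Lcoef_def
      by (intro bounded_linear_compose[OF bounded_linear_vec_nth] bounded_linear_vec_nth)
    then have "((\<lambda>L :: complex^3^3^'n::enum. Lcoef L r $ i $ j) has_derivative
        (\<lambda>V. Lcoef V r $ i $ j)) (at L within phase_space)"
      by (rule bounded_linear_imp_has_derivative)
    moreover have "covector (?e r i j) = (\<lambda>V :: complex^3^3^'n::enum. Lcoef V r $ i $ j)"
      using c[OF that] by (intro ext)
    ultimately show ?thesis by (simp add: has_differential_def)
  qed
  then have "poisson (\<lambda>L. Lcoef L r $ i $ j) (\<lambda>L. Lcoef L s $ k $ l) L
      = bivector L (?e r i j) (?e s k l)"
    using assms by (intro poisson_eq_bivector)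
  also have "\<dots> = coord_bracket L r i j s k l"
    using assms(1,2)
    by (simp add: bivector_def if_distrib[of "\<lambda>x. x * _"] if_distrib[of "\<lambda>x. _ * x"] cong: if_cong)
  finally show ?thesis .
qed


section \<open>Orbits and forms on them\<close>

definition orbit ::
  "real \<Rightarrow> real \<Rightarrow> (nat \<Rightarrow> real) \<Rightarrow> (nat \<Rightarrow> real) \<Rightarrow> (complex^3^3^'n::enum) set" where
  "orbit m q c b = {L \<in> phase_space. \<forall>j<CARD('n).
     coeff (I2 m q L) j = complex_of_real (c j) \<and> coeff (I3 m q L) j = complex_of_real (b j)}"

definition differential ::
  "(complex^3^3^'n::enum \<Rightarrow> complex) \<Rightarrow> complex^3^3^'n::enum \<Rightarrow> complex^3^3^'n::enum \<Rightarrow> complex" where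
  "differential f L = frechet_derivative f (at L within phase_space)"

definition orbit_tangent ::
  "real \<Rightarrow> real \<Rightarrow> complex^3^3^'n::enum \<Rightarrow> (complex^3^3^'n::enum) set" where
  "orbit_tangent m q L = {V \<in> phase_space. \<forall>j<CARD('n).
     differential (\<lambda>L'. coeff (I2 m q L') j) L V = 0 \<and>
     differential (\<lambda>L'. coeff (I3 m q L') j) L V = 0}"

text \<open>
  Generic: a regular level set of the \<open>2N\<close> Casimir functions, of real dimension \<open>8N - 2N = 6N\<close>.
  The parameter \<open>S\<close> is the orbit.
\<close>

definition generic_orbit :: "real \<Rightarrow> real \<Rightarrow> (complex^3^3^'n::enum) set \<Rightarrow> bool" where
  "generic_orbit m q S \<longleftrightarrow>
     (\<exists>c b. S = orbit m q c b) \<and> (\<forall>L\<in>S. dim (orbit_tangent m q L) = 6 * CARD('n))"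

definition hamiltonian_vector ::
  "complex^3^3^'n::enum \<Rightarrow> (nat \<Rightarrow> 3 \<Rightarrow> 3 \<Rightarrow> complex) \<Rightarrow> complex^3^3^'n::enum \<Rightarrow> bool" where
  "hamiltonian_vector L a V \<longleftrightarrow> (\<forall>s<CARD('n). \<forall>k l. Lcoef V s $ k $ l =
     (\<Sum>r<CARD('n). \<Sum>i\<in>UNIV. \<Sum>j\<in>UNIV. a r i j * coord_bracket L r i j s k l))"

text \<open>
  The symplectic form of the orbit, i.e. the inverse of the bracket: on the Hamiltonian vectors of
  \<open>f\<close> and \<open>g\<close> it takes the value \<open>- {f, g}\<close>.  With this sign it is the sum of the \<open>dp \<and> dq\<close>, the
  exterior derivative of the sum of the \<open>p dq\<close>, in canonical coordinates with \<open>{q, p} = 1\<close>.  As the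
  bracket of the real functions is purely imaginary, a real tangent vector is the Hamiltonian
  vector of a covector with complex coefficients, and the form is complex-valued.
\<close>

definition symplectic_form ::
  "complex^3^3^'n::enum \<Rightarrow> complex^3^3^'n::enum \<Rightarrow> complex^3^3^'n::enum \<Rightarrow> complex" where
  "symplectic_form L u v =
     - bivector L (SOME a. hamiltonian_vector L a u) (SOME b. hamiltonian_vector L b v)"

definition ext_deriv ::
  "(complex^3^3^'n::enum \<Rightarrow> complex^3^3^'n::enum \<Rightarrow> complex) \<Rightarrow>
   complex^3^3^'n::enum \<Rightarrow> complex^3^3^'n::enum \<Rightarrow> complex^3^3^'n::enum \<Rightarrow> complex" where
  "ext_deriv \<Omega> L u v = differential (\<lambda>L'. \<Omega> L' v) L u - differential (\<lambda>L'. \<Omega> L' u) L v"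

text \<open>
  \<open>\<Omega>\<close>, a one-form on a neighbourhood in the phase space of each point of \<open>S\<close>, restricts to a
  Liouville form on the part \<open>S\<close> of an orbit: its restriction is a primitive of the symplectic
  form.  Restriction to the orbit commutes with the exterior derivative, so the latter is taken in
  the phase space and evaluated on vectors tangent to the orbit.
\<close>

definition liouville_form ::
  "real \<Rightarrow> real \<Rightarrow> (complex^3^3^'n::enum) set \<Rightarrow>
   (complex^3^3^'n::enum \<Rightarrow> complex^3^3^'n::enum \<Rightarrow> complex) \<Rightarrow> bool" where
  "liouville_form m q S \<Omega> \<longleftrightarrow> (\<forall>L\<in>S.
     (\<forall>v\<in>phase_space. (\<lambda>L'. \<Omega> L' v) differentiable (at L within phase_space)) \<and>
     (\<forall>u\<in>orbit_tangent m q L. \<forall>v\<in>orbit_tangent m q L.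
        ext_deriv \<Omega> L u v = symplectic_form L u v))"

definition Omega ::
  "(nat \<Rightarrow> complex^3^3^'n::enum \<Rightarrow> complex) \<Rightarrow> (nat \<Rightarrow> complex^3^3^'n::enum \<Rightarrow> complex) \<Rightarrow>
   complex^3^3^'n::enum \<Rightarrow> complex^3^3^'n::enum \<Rightarrow> complex" where
  "Omega lam w L v =
     - (\<Sum>k<3 * CARD('n). lam k L powi (- int CARD('n)) * w k L * differential (lam k) L v)"


section \<open>Variables of separation\<close>

text \<open>
  A local branch, on an open part \<open>U\<close> of the phase space, of the roots of \<open>\<B>\<close> together with the
  values of \<open>\<A>\<close> at them.  The two expressions for \<open>\<A>\<close> both make sense where \<open>L_31\<close> and \<open>L_32\<close> do
  not vanish.
\<close>

definition separation_variables ::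
  "real \<Rightarrow> real \<Rightarrow> (complex^3^3^'n::enum) set \<Rightarrow> (nat \<Rightarrow> complex^3^3^'n::enum \<Rightarrow> complex) \<Rightarrow>
   (nat \<Rightarrow> complex^3^3^'n::enum \<Rightarrow> complex) \<Rightarrow> bool" where
  "separation_variables m q U lam w \<longleftrightarrow>
     openin (top_of_set phase_space) U \<and>
     (\<forall>k<3 * CARD('n). continuous_on U (lam k)) \<and>
     (\<forall>L\<in>U. inj_on (\<lambda>k. lam k L) {..<3 * CARD('n)} \<and>
        (\<forall>k<3 * CARD('n). poly (Bpoly m q L) (lam k L) = 0 \<and>
           Leval m q L (lam k L) $ 3 $ 1 \<noteq> 0 \<and> Leval m q L (lam k L) $ 3 $ 2 \<noteq> 0 \<and>
           w k L = Afun m q L (lam k L)))"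

end

theory Submission
  imports Defs
begin

text \<open>
  At a root of \<open>\<B>\<close> the vector \<open>(L_32, - L_31, 0)\<close> is an eigenvector of \<open>L(\<lambda>)\<close> with eigenvalue
  \<open>w = \<A>(\<lambda>)\<close>.  Hence \<open>(\<lambda>, w)\<close> lies on the spectral curve and is an implicit solution of the equations
  \<open>F_1 = (L_11 - w) L_32 - L_12 L_31 = 0\<close> and \<open>F_2 = (L_22 - w) L_31 - L_21 L_32 = 0\<close>, and its
  differential is a combination of \<open>d_L F_1\<close> and \<open>d_L F_2\<close>.  The bracket of two evaluations
  of \<open>L\<close> at \<open>x\<close>, \<open>y\<close> is governed by the matrix \<open>(x^N L(y) - y^N L(x)) / (x - y)\<close>.  With it all brackets
  of \<open>F_1\<close>, \<open>F_2\<close> at different roots vanish, and at the same root \<open>{F_1, F_2} = \<lambda>^N \<B>'(\<lambda>)\<close>.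

  The second derivatives of \<open>\<lambda>_k\<close> drop out of \<open>d \<Omega>\<close> by symmetry.  To compare what is left with the
  symplectic form, tangent vectors of the orbit have to be Hamiltonian.  This is a dimension
  count in the complexified tangent space, which contains all Hamiltonian vectors because the
  coefficients of \<open>I2\<close> and \<open>I3\<close> of degree less than \<open>N\<close> are Casimir functions with real values.
\<close>

section \<open>Analytic preliminaries\<close>

text \<open>Expanding \<open>G\<close> at \<open>(a, l a)\<close> bounds the error \<open>r\<close>
  of the claimed approximation by a small multiple of
  \<open>norm (x - a) + norm (l x - l a)\<close>. As \<open>norm (l x - l a)\<close> is at most
  \<open>norm r\<close> plus a multiple of \<open>norm (x - a)\<close>, the contribution of
  \<open>r\<close> can be absorbed.\<close>

lemma implicit_has_derivative:
  fixes G :: "'a::real_normed_vector \<times> complex \<Rightarrow> complex"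
  assumes G: "(G has_derivative D) (at (a, l a))"
    and D: "\<And>z. D (0, z) = d * z" and d: "d \<noteq> 0"
    and l: "(l \<longlongrightarrow> l a) (at a within S)"
    and z: "\<forall>x\<in>S. G (x, l x) = 0" and a: "a \<in> S"
  shows "(l has_derivative (\<lambda>v. - D (v, 0) / d)) (at a within S)"
proof -
  have blD: "bounded_linear D" using G by (rule has_derivative_bounded_linear)
  have bl: "bounded_linear (\<lambda>v. D (v, 0))"
    by (rule bounded_linear_compose[OF blD]) (intro bounded_linear_Pair bounded_linear_ident bounded_linear_zero)
  then obtain C where C: "\<And>v. norm (D (v, 0)) \<le> norm v * C" and C0: "C > 0"
    using bounded_linear.pos_bounded by blast
  have Dsplit: "D (v, z) = D (v, 0) + d * z" for v z
    using linear_add[OF bounded_linear.linear[OF blD], of "(v, 0)" "(0, z)"] D by simp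
  define K where "K = 1 + C / norm d"
  have K0: "K > 0" using C0 d by (simp add: K_def add_pos_nonneg)
  show ?thesis
    unfolding has_derivative_within_alt2
  proof (intro conjI allI impI)
    show "bounded_linear (\<lambda>v. - D (v, 0) / d)"
      using bounded_linear_compose[OF bounded_linear_mult_right[of "- 1 / d"] bl]
      by (simp add: field_simps)
    fix e :: real assume e: "e > 0"
    \<comment> \<open>The first bound lets half of \<open>norm d * norm r\<close> absorb the term in
      \<open>norm r\<close>; the second turns what remains into \<open>e\<close>.\<close>
    define e' where "e' = min (norm d / 2) (e * norm d / (2 * K))"
    have e': "e' > 0" using e d K0 by (simp add: e'_def)
    have e1: "e' \<le> norm d / 2" and e2: "e' * K \<le> e * (norm d / 2)"
    proof -
      have "e' \<le> e * norm d / (2 * K)" by (simp add: e'_def)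
      then have "e' * K \<le> e * norm d / (2 * K) * K"
        using K0 by (intro mult_right_mono) auto
      then show "e' * K \<le> e * (norm d / 2)" using K0 by (simp add: field_simps)
    qed (simp add: e'_def)
    from G e' obtain \<delta> where \<delta>: "\<delta> > 0" and
      b: "\<And>y. norm (y - (a, l a)) < \<delta> \<Longrightarrow>
        norm (G y - G (a, l a) - D (y - (a, l a))) \<le> e' * norm (y - (a, l a))"
      unfolding has_derivative_at_alt by blast
    have "((\<lambda>x. (x, l x)) \<longlongrightarrow> (a, l a)) (at a within S)"
      by (intro tendsto_Pair tendsto_ident_at l)
    then have "\<forall>\<^sub>F x in at a within S. dist (x, l x) (a, l a) < \<delta>"
      using \<delta> by (rule tendstoD)
    moreover have "\<forall>\<^sub>F x in at a within S. x \<in> S"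
      by (simp add: eventually_at_filter)
    ultimately show "\<forall>\<^sub>F x in at a within S.
        norm (l x - l a - - D (x - a, 0) / d) \<le> e * norm (x - a)"
    proof eventually_elim
      case (elim x)
      define r where "r = l x - l a + D (x - a, 0) / d"
      have "norm (D (x - a, l x - l a)) \<le> e' * norm (x - a, l x - l a)"
        using b[of "(x, l x)"] elim z a by (simp add: dist_norm)
      moreover have "D (x - a, l x - l a) = d * r"
        using Dsplit[of "x - a" "l x - l a"] d by (simp add: r_def distrib_left)
      moreover have "norm (x - a, l x - l a) \<le> norm (x - a) + norm (l x - l a)"
        by (rule norm_Pair_le)
      moreover have "norm (l x - l a) \<le> norm r + norm (x - a) * C / norm d"
      proof -
        have "l x - l a = r - D (x - a, 0) / d" by (simp add: r_def)
        then have "norm (l x - l a) \<le> norm r + norm (D (x - a, 0)) / norm d"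
          by (metis norm_divide norm_triangle_ineq4)
        also have "\<dots> \<le> norm r + norm (x - a) * C / norm d"
          using C[of "x - a"] by (simp add: divide_right_mono)
        finally show ?thesis .
      qed
      ultimately have "norm d * norm r \<le> e' * (norm (x - a) + (norm r + norm (x - a) * C / norm d))"
        by (smt (verit) e' mult_left_mono norm_mult)
      also have "\<dots> = e' * K * norm (x - a) + e' * norm r" by (simp add: K_def algebra_simps)
      also have "\<dots> \<le> e * (norm d / 2) * norm (x - a) + norm d / 2 * norm r"
        by (intro add_mono mult_right_mono e1 e2) auto
      finally have "norm d / 2 * norm r \<le> norm d / 2 * (e * norm (x - a))" by (simp add: algebra_simps)
      then have "norm r \<le> e * norm (x - a)" using d by simp
      then show ?case by (simp add: r_def)
    qed
  qed
qed

text \<open>\<open>phase_space\<close> is a proper real subspace, so a derivative within it is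
  determined only on its own directions. Restriction to the line through \<open>L\<close> along
  \<open>V\<close> compares the derivative chosen by \<open>differential\<close> with
  \<open>D\<close>.\<close>

lemma differential_eq:
  assumes f: "(f has_derivative D) (at L within phase_space)"
    and L: "(L :: complex^3^3^'n::enum) \<in> phase_space" and V: "V \<in> phase_space"
  shows "differential f L V = D V"
proof -
  have sub: "range (\<lambda>t. L + t *\<^sub>R V) \<subseteq> phase_space"
    using phase_space_affine[OF L V] by blast
  have D: "((\<lambda>t. f (L + t *\<^sub>R V)) has_derivative (\<lambda>t. D (t *\<^sub>R V))) (at (0::real))"
    if "(f has_derivative D) (at L within phase_space)" for D
  proof -
    have "((\<lambda>t. L + t *\<^sub>R V) has_derivative (\<lambda>t. t *\<^sub>R V)) (at (0::real))"
      by (auto intro!: derivative_eq_intros)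
    moreover have "(f has_derivative D) (at (L + 0 *\<^sub>R V) within range (\<lambda>t. L + t *\<^sub>R V))"
      using has_derivative_subset[OF that sub] by simp
    ultimately show ?thesis
      using has_derivative_in_compose[of "\<lambda>t. L + t *\<^sub>R V" "\<lambda>t. t *\<^sub>R V" 0 UNIV f D] by simp
  qed
  have "(f has_derivative differential f L) (at L within phase_space)"
    using f unfolding differential_def by (metis differentiableI frechet_derivative_works)
  from has_derivative_unique[OF D[OF this] D[OF f]] show ?thesis
    by (metis scaleR_one)
qed

lemma at_within_openin:
  assumes "openin (top_of_set T) U" "x \<in> U"
  shows "at x within U = at x within T"
proof -
  from assms obtain O' where "open O'" "U = T \<inter> O'" by (auto simp: openin_open)
  then show ?thesis using assms(2) by (intro at_within_nhd[of x O']) auto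
qed

text \<open>\<open>a\<close> and \<open>b\<close> only bound the degrees. In the convolution, an
  index below \<open>a\<close> in \<open>p\<close> forces one above \<open>b\<close> in
  \<open>q\<close>, so a single summand survives.\<close>

lemma coeff_mult_degree_le:
  fixes p q :: "'a::comm_semiring_0 poly"
  assumes "degree p \<le> a" "degree q \<le> b"
  shows "coeff (p * q) (a + b) = coeff p a * coeff q b"
proof -
  have "coeff (p * q) (a + b) = (\<Sum>i\<le>a + b. if i = a then coeff p a * coeff q b else 0)"
    unfolding coeff_mult
  proof (intro sum.cong refl)
    fix i assume "i \<in> {..a + b}"
    show "coeff p i * coeff q (a + b - i) = (if i = a then coeff p a * coeff q b else 0)"
    proof (cases i a rule: linorder_cases)
      case less
      then have "coeff q (a + b - i) = 0" using assms by (intro coeff_eq_0) auto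
      then show ?thesis using less by simp
    next
      case greater
      then have "coeff p i = 0" using assms by (intro coeff_eq_0) auto
      then show ?thesis using greater by simp
    qed auto
  qed
  then show ?thesis by simp
qed

text \<open>If \<open>r k\<close> were a double root, the cofactor of \<open>[:- r k, 1:]\<close>,
  of degree \<open>n - 1\<close>, would still have all \<open>n\<close> roots.\<close>

lemma poly_pderiv_nonzero_of_distinct_roots:
  fixes p :: "'a::idom poly"
  assumes p: "degree p = n" "n > 0" and r: "inj_on r {..<n}" "\<And>k. k < n \<Longrightarrow> poly p (r k) = 0" and k: "k < n"
  shows "poly (pderiv p) (r k) \<noteq> 0"
proof
  assume z: "poly (pderiv p) (r k) = 0"
  obtain s where s: "p = [:- r k, 1:] * s" using r(2)[OF k] by (auto simp: poly_eq_0_iff_dvd)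
  have p0: "p \<noteq> 0" using p by auto
  then have s0: "s \<noteq> 0" using s by auto
  have deg: "degree p = Suc (degree s)"
    using degree_mult_eq[of "[:- r k, 1:]" s] s0 unfolding s by simp
  have sk: "poly s (r k) = 0"
    using z unfolding s pderiv_mult by (simp add: pderiv_pCons)
  have "r ` {..<n} \<subseteq> {x. poly s x = 0}"
  proof (rule image_subsetI)
    fix l assume l: "l \<in> {..<n}"
    show "r l \<in> {x. poly s x = 0}"
    proof (cases "l = k")
      case False
      then have "r l \<noteq> r k" using l k r(1) by (auto dest: inj_onD)
      then show ?thesis using r(2)[of l] l s by auto
    qed (use sk in simp)
  qed
  then have "card (r ` {..<n}) \<le> card {x. poly s x = 0}"
    by (intro card_mono poly_roots_finite s0)
  also have "\<dots> \<le> degree s" by (rule card_poly_roots_bound[OF s0])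
  finally show False using card_image[OF r(1)] deg p by simp
qed

section \<open>The polynomial B and its derivatives\<close>

text \<open>\<open>\<B>\<close> as a cubic form in the entries of one matrix, with
  \<open>dBform\<close> and \<open>ddBform\<close> its first and second derivative forms. All
  derivatives in \<open>L\<close> and in \<lambda> then come from these by the chain rule.\<close>

definition Bform :: "(3 \<Rightarrow> 3 \<Rightarrow> complex) \<Rightarrow> complex" where
  "Bform E = (E 1 1 - E 2 2) * E 3 1 * E 3 2 - E 1 2 * (E 3 1)\<^sup>2 + E 2 1 * (E 3 2)\<^sup>2"

definition dBform :: "(3 \<Rightarrow> 3 \<Rightarrow> complex) \<Rightarrow> (3 \<Rightarrow> 3 \<Rightarrow> complex) \<Rightarrow> complex" where
  "dBform E V = (V 1 1 - V 2 2) * E 3 1 * E 3 2 + (E 1 1 - E 2 2) * (V 3 1 * E 3 2 + E 3 1 * V 3 2)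
     - V 1 2 * (E 3 1)\<^sup>2 - 2 * E 1 2 * E 3 1 * V 3 1 + V 2 1 * (E 3 2)\<^sup>2 + 2 * E 2 1 * E 3 2 * V 3 2"

definition ddBform :: "(3 \<Rightarrow> 3 \<Rightarrow> complex) \<Rightarrow> (3 \<Rightarrow> 3 \<Rightarrow> complex) \<Rightarrow> (3 \<Rightarrow> 3 \<Rightarrow> complex) \<Rightarrow> complex" where
  "ddBform E U V = (V 1 1 - V 2 2) * (U 3 1 * E 3 2 + E 3 1 * U 3 2)
     + (U 1 1 - U 2 2) * (V 3 1 * E 3 2 + E 3 1 * V 3 2)
     + (E 1 1 - E 2 2) * (V 3 1 * U 3 2 + U 3 1 * V 3 2)
     - 2 * V 1 2 * E 3 1 * U 3 1 - 2 * U 1 2 * E 3 1 * V 3 1 - 2 * E 1 2 * U 3 1 * V 3 1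
     + 2 * V 2 1 * E 3 2 * U 3 2 + 2 * U 2 1 * E 3 2 * V 3 2 + 2 * E 2 1 * U 3 2 * V 3 2"

lemma Bform_has_derivative:
  assumes "\<And>i j. ((\<lambda>t. e t i j) has_derivative (\<lambda>h. e' h i j)) (at t within S)"
  shows "((\<lambda>t. Bform (e t)) has_derivative (\<lambda>h. dBform (e t) (e' h))) (at t within S)"
  unfolding Bform_def dBform_def power2_eq_square
  by (rule derivative_eq_intros assms refl)+ (simp add: fun_eq_iff algebra_simps)

lemma dBform_has_derivative:
  assumes "\<And>i j. ((\<lambda>t. e t i j) has_derivative (\<lambda>h. e' h i j)) (at t within S)"
    and "\<And>i j. ((\<lambda>t. v t i j) has_derivative (\<lambda>h. v' h i j)) (at t within S)"
  shows "((\<lambda>t. dBform (e t) (v t)) has_derivative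
    (\<lambda>h. ddBform (e t) (e' h) (v t) + dBform (e t) (v' h))) (at t within S)"
  unfolding ddBform_def dBform_def power2_eq_square
  by (rule derivative_eq_intros assms refl)+ (simp add: fun_eq_iff algebra_simps)

lemma dBform_linear:
  "dBform E (\<lambda>i j. U i j + V i j) = dBform E U + dBform E V"
  "dBform E (\<lambda>i j. c * V i j) = c * dBform E V"
  by (simp_all add: dBform_def algebra_simps)

lemma ddBform_linear:
  "ddBform E (\<lambda>i j. U i j + V i j) W = ddBform E U W + ddBform E V W"
  "ddBform E (\<lambda>i j. c * V i j) W = c * ddBform E V W"
  by (simp_all add: ddBform_def algebra_simps)

lemma ddBform_sym: "ddBform E U V = ddBform E V U"
  by (simp add: ddBform_def algebra_simps)

text \<open>
  Evaluation of the dynamic part of a matrix polynomial against weights \<open>c\<close>; the weights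
  \<open>pw z\<close>, \<open>dpw z\<close>, \<open>ddpw z\<close> defined below yield the value and the first two derivatives at \<open>z\<close>.
\<close>

definition ev :: "(nat \<Rightarrow> complex) \<Rightarrow> complex^3^3^'n::enum \<Rightarrow> 3 \<Rightarrow> 3 \<Rightarrow> complex" where
  "ev c V i j = (\<Sum>p<CARD('n). c p * Lcoef V p $ i $ j)"

text \<open>Only points of the phase space carry the fixed leading coefficient; tangent vectors have
  none and are evaluated by \<open>ev\<close>.\<close>

definition evL :: "real \<Rightarrow> real \<Rightarrow> (nat \<Rightarrow> complex) \<Rightarrow> complex^3^3^'n::enum \<Rightarrow> 3 \<Rightarrow> 3 \<Rightarrow> complex" where
  "evL m q c L i j = ev c L i j + c CARD('n) * lead_coef m q $ i $ j"

definition pw :: "complex \<Rightarrow> nat \<Rightarrow> complex" where "pw z p = z ^ p"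
definition dpw :: "complex \<Rightarrow> nat \<Rightarrow> complex" where "dpw z p = of_nat p * z ^ (p - 1)"
text \<open>The truncated subtractions are harmless: for \<open>p \<le> 1\<close> one of the factors
  is zero.\<close>

definition ddpw :: "complex \<Rightarrow> nat \<Rightarrow> complex" where
  "ddpw z p = of_nat p * (of_nat (p - 1) * z ^ (p - 1 - 1))"

lemma pw_DERIV: "((\<lambda>z. pw z p) has_field_derivative dpw z p) (at z within S)"
  unfolding pw_def dpw_def by (auto intro!: derivative_eq_intros)

lemma dpw_DERIV: "((\<lambda>z. dpw z p) has_field_derivative ddpw z p) (at z within S)"
  unfolding ddpw_def dpw_def by (auto intro!: derivative_eq_intros)

lemma bounded_linear_Lcoef: "bounded_linear (\<lambda>V :: complex^3^3^'n::enum. Lcoef V p $ i $ j)"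
  unfolding Lcoef_def
  by (intro bounded_linear_compose[OF bounded_linear_vec_nth] bounded_linear_vec_nth)

lemma evL_has_derivative:
  fixes F :: "'b::real_normed_vector \<Rightarrow> complex^3^3^'n::enum"
  assumes c: "\<And>p. ((\<lambda>z. c z p) has_field_derivative c' p) (at (l t))"
    and l: "(l has_derivative l') (at t within S)" and F: "(F has_derivative F') (at t within S)"
  shows "((\<lambda>t. evL m q (c (l t)) (F t) i j) has_derivative
    (\<lambda>h. ev (c (l t)) (F' h) i j + l' h * evL m q c' (F t) i j)) (at t within S)"
proof -
  have C: "((\<lambda>t. c (l t) p) has_derivative (\<lambda>h. l' h * c' p)) (at t within S)" for p
    using has_derivative_compose[OF l c[of p, unfolded has_field_derivative_def]]
    by (simp add: mult.commute)
  have L: "((\<lambda>t. Lcoef (F t) p $ i $ j) has_derivative (\<lambda>h. Lcoef (F' h) p $ i $ j)) (at t within S)" for p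
    by (rule bounded_linear.has_derivative[OF bounded_linear_Lcoef F])
  show ?thesis
    unfolding evL_def ev_def
    by (rule derivative_eq_intros C L refl)+
      (simp add: fun_eq_iff sum.distrib sum_distrib_left algebra_simps)
qed

lemma ev_has_derivative:
  fixes v :: "complex^3^3^'n::enum"
  assumes c: "\<And>p. ((\<lambda>z. c z p) has_field_derivative c' p) (at (l t))"
    and l: "(l has_derivative l') (at t within S)"
  shows "((\<lambda>t. ev (c (l t)) v i j) has_derivative (\<lambda>h. l' h * ev c' v i j)) (at t within S)"
proof -
  have C: "((\<lambda>t. c (l t) p) has_derivative (\<lambda>h. l' h * c' p)) (at t within S)" for p
    using has_derivative_compose[OF l c[of p, unfolded has_field_derivative_def]]
    by (simp add: mult.commute)
  show ?thesis
    unfolding ev_def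
    by (rule derivative_eq_intros C refl)+ (simp add: fun_eq_iff sum_distrib_left algebra_simps)
qed

lemma Leval_eq: "Leval m q L z $ i $ j = evL m q (pw z) (L :: complex^3^3^'n::enum) i j"
  by (simp add: Leval_def Lpoly_def evL_def ev_def pw_def poly_sum poly_monom mult.commute)

lemma poly_Bpoly: "poly (Bpoly m q L) z = Bform (evL m q (pw z) (L :: complex^3^3^'n::enum))"
  by (simp add: Bpoly_def Let_def Bform_def Leval_eq[symmetric] Leval_def poly_mult poly_power)

lemma poly_pderiv_Bpoly:
  "poly (pderiv (Bpoly m q L)) z
     = dBform (evL m q (pw z) L) (evL m q (dpw z) (L :: complex^3^3^'n::enum))"
proof -
  have "((\<lambda>z. poly (Bpoly m q L) z) has_derivative
      (\<lambda>h. dBform (evL m q (pw z) L) (\<lambda>i j. ev (pw z) (0 :: complex^3^3^'n::enum) i j + h * evL m q (dpw z) L i j))) (at z)"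
    unfolding poly_Bpoly
    by (rule Bform_has_derivative[where e = "\<lambda>z. evL m q (pw z) L"],
        rule evL_has_derivative[where l = "\<lambda>z. z" and F = "\<lambda>_. L" and F' = "\<lambda>_. 0"])
      (auto intro: pw_DERIV)
  also have "(\<lambda>h. dBform (evL m q (pw z) L) (\<lambda>i j. ev (pw z) (0 :: complex^3^3^'n::enum) i j + h * evL m q (dpw z) L i j))
      = (\<lambda>h. h * dBform (evL m q (pw z) L) (evL m q (dpw z) L))"
    by (simp add: ev_def Lcoef_def dBform_linear)
  finally have "DERIV (poly (Bpoly m q L)) z :> dBform (evL m q (pw z) L) (evL m q (dpw z) L)"
    by (simp add: has_field_derivative_def mult_commute_abs)
  then show ?thesis using DERIV_unique poly_DERIV by blast
qed

lemma coeff_Lpoly: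
  "coeff (Lpoly m q L $ i $ j) p = (if p < CARD('n) then Lcoef (L :: complex^3^3^'n::enum) p $ i $ j
     else if p = CARD('n) then lead_coef m q $ i $ j else 0)"
  by (simp add: Lpoly_def coeff_sum sum.delta' cong: if_cong)

lemma degree_Lpoly: "degree (Lpoly m q (L :: complex^3^3^'n::enum) $ i $ j) \<le> CARD('n)"
  by (rule degree_le) (simp add: coeff_Lpoly)

text \<open>The coefficient of degree \<open>3 * CARD('n)\<close> is the cubic form at
  \<open>lead_coef m q\<close>, which is a nonzero multiple of
  \<open>m * (9 * q\<^sup>2 - m\<^sup>2)\<close>.\<close>

lemma degree_Bpoly:
  assumes "m \<noteq> 0" "m \<noteq> 3 * q" "m \<noteq> - 3 * q"
  shows "degree (Bpoly m q (L :: complex^3^3^'n::enum)) = 3 * CARD('n)"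
proof -
  let ?N = "CARD('n)" and ?P = "Lpoly m q L"
  have d: "degree (?P $ i $ j) \<le> ?N" for i j by (rule degree_Lpoly)
  have c: "coeff (?P $ i $ j) ?N = lead_coef m q $ i $ j" for i j by (simp add: coeff_Lpoly)
  have e: "Bpoly m q L = (?P $ 1 $ 1 - ?P $ 2 $ 2) * ?P $ 3 $ 1 * ?P $ 3 $ 2
     - ?P $ 1 $ 2 * ?P $ 3 $ 1 * ?P $ 3 $ 1 + ?P $ 2 $ 1 * ?P $ 3 $ 2 * ?P $ 3 $ 2"
    by (simp add: Bpoly_def Let_def power2_eq_square mult.assoc)
  \<comment> \<open>The first factor is an arbitrary \<open>p\<close> because in one of the three
    terms of \<open>\<B>\<close> it is a difference of two entries.\<close>
  have t: "degree (p * ?P $ i $ j * ?P $ k $ l) \<le> ?N + ?N + ?N \<and>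
      coeff (p * ?P $ i $ j * ?P $ k $ l) (?N + ?N + ?N)
        = coeff p ?N * lead_coef m q $ i $ j * lead_coef m q $ k $ l"
    if "degree p \<le> ?N" for p i j k l
  proof -
    have "degree (p * ?P $ i $ j) \<le> ?N + ?N"
      using degree_mult_le[of p "?P $ i $ j"] that d[of i j] by linarith
    then show ?thesis
      using degree_mult_le[of "p * ?P $ i $ j" "?P $ k $ l"] d[of k l]
      by (auto simp: coeff_mult_degree_le that d c intro: order_trans[OF _ add_mono])
  qed
  have dd: "degree (?P $ 1 $ 1 - ?P $ 2 $ 2) \<le> ?N" by (intro degree_diff_le d)
  have "degree (Bpoly m q L) \<le> ?N + ?N + ?N"
    unfolding e by (intro degree_add_le degree_diff_le t[THEN conjunct1] d dd)
  moreover have "coeff (Bpoly m q L) (?N + ?N + ?N) \<noteq> 0"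
  proof -
    define a where "a = complex_of_real (m / (2 * sqrt 2))"
    have a2: "a * a = complex_of_real (m\<^sup>2 / 8)"
      by (simp add: a_def power2_eq_square flip: of_real_mult)
    have "coeff (Bpoly m q L) (?N + ?N + ?N)
        = (of_real (q / 2) - of_real (- q / 4)) * a * of_real (3 * q / 4) - a * a * a
          + a * of_real (3 * q / 4) * of_real (3 * q / 4)"
      unfolding e by (simp add: t d dd c lead_coef_eq vector_3 a_def)
    also have "\<dots> = a * complex_of_real ((9 * q\<^sup>2 - m\<^sup>2) / 8)"
      by (simp add: mult.assoc a2) (simp add: field_simps power2_eq_square)
    finally have "coeff (Bpoly m q L) (?N + ?N + ?N) = a * complex_of_real ((9 * q\<^sup>2 - m\<^sup>2) / 8)" .
    moreover have "(9 * q\<^sup>2 - m\<^sup>2) / 8 \<noteq> 0"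
    proof -
      have "9 * q\<^sup>2 - m\<^sup>2 = (3 * q - m) * (3 * q + m)"
        by (simp add: power2_eq_square algebra_simps)
      then show ?thesis using assms by auto
    qed
    ultimately show ?thesis using assms(1) by (simp only: of_real_eq_0_iff mult_eq_0_iff) (simp add: a_def)
  qed
  ultimately show ?thesis using le_degree[of "Bpoly m q L" "?N + ?N + ?N"] by simp
qed

section \<open>The bracket of evaluation covectors\<close>

definition dot :: "(3 \<Rightarrow> 3 \<Rightarrow> complex) \<Rightarrow> (3 \<Rightarrow> 3 \<Rightarrow> complex) \<Rightarrow> complex" where
  "dot \<beta> V = (\<Sum>i\<in>UNIV. \<Sum>j\<in>UNIV. \<beta> i j * V i j)"

text \<open>The differential of the function pairing \<beta> with the value of the matrix polynomial
  at a fixed \<open>z\<close>.\<close>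

definition ecov :: "complex \<Rightarrow> (3 \<Rightarrow> 3 \<Rightarrow> complex) \<Rightarrow> nat \<Rightarrow> 3 \<Rightarrow> 3 \<Rightarrow> complex" where
  "ecov z \<beta> r i j = z ^ r * \<beta> i j"

lemma covector_ecov: "covector (ecov z \<beta>) V = dot \<beta> (ev (pw z) (V :: complex^3^3^'n::enum))"
proof -
  have "covector (ecov z \<beta>) V = (\<Sum>i\<in>UNIV. \<Sum>j\<in>UNIV. \<Sum>r<CARD('n). ecov z \<beta> r i j * Lcoef V r $ i $ j)"
    unfolding covector_def by (subst sum.swap, rule sum.cong[OF refl], rule sum.swap)
  then show ?thesis
    by (simp add: dot_def ev_def ecov_def pw_def sum_distrib_left mult.assoc mult.left_commute)
qed

text \<open>What remains of the bracket of two such differentials once the degrees are summed out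
  into \<open>K\<close>: the Lie-Poisson bracket of gl(3) at \<open>K\<close> of the linear
  functions \<beta> and \<gamma>.\<close>

definition brk :: "(3 \<Rightarrow> 3 \<Rightarrow> complex) \<Rightarrow> (3 \<Rightarrow> 3 \<Rightarrow> complex) \<Rightarrow> (3 \<Rightarrow> 3 \<Rightarrow> complex) \<Rightarrow> complex" where
  "brk \<beta> \<gamma> K = (\<Sum>i\<in>UNIV. \<Sum>j\<in>UNIV. \<Sum>k\<in>UNIV. \<Sum>l\<in>UNIV.
     \<beta> i j * \<gamma> k l * ((if i = l then K k j else 0) - (if k = j then K i l else 0)))"

lemma brk_add: "brk \<beta> \<gamma> (\<lambda>i j. K i j + M i j) = brk \<beta> \<gamma> K + brk \<beta> \<gamma> M"
  unfolding brk_def sum.distrib[symmetric]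
  by (intro sum.cong refl) (simp add: algebra_simps)

lemma brk_scale: "brk \<beta> \<gamma> (\<lambda>i j. c * K i j) = c * brk \<beta> \<gamma> K"
  unfolding brk_def sum_distrib_left
  by (intro sum.cong refl) (simp add: algebra_simps)

lemma brk_diff: "brk \<beta> \<gamma> (\<lambda>i j. K i j - M i j) = brk \<beta> \<gamma> K - brk \<beta> \<gamma> M"
  using brk_add[of \<beta> \<gamma> K "\<lambda>i j. - 1 * M i j"] brk_scale[of \<beta> \<gamma> "- 1" M] by simp

lemma brk_sum: "finite A \<Longrightarrow> brk \<beta> \<gamma> (\<lambda>i j. \<Sum>a\<in>A. K a i j) = (\<Sum>a\<in>A. brk \<beta> \<gamma> (K a))"
proof (induction A rule: finite_induct)
  case empty
  then show ?case by (simp add: brk_def)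
qed (simp add: brk_add)

lemma brk_comb_left: "brk (\<lambda>i j. a * \<beta> i j + b * \<beta>' i j) \<gamma> K = a * brk \<beta> \<gamma> K + b * brk \<beta>' \<gamma> K"
  unfolding brk_def sum_distrib_left sum.distrib[symmetric]
  by (intro sum.cong refl) (simp add: algebra_simps)

lemma brk_comb_right: "brk \<beta> (\<lambda>i j. a * \<gamma> i j + b * \<gamma>' i j) K = a * brk \<beta> \<gamma> K + b * brk \<beta> \<gamma>' K"
  unfolding brk_def sum_distrib_left sum.distrib[symmetric]
  by (intro sum.cong refl) (simp add: algebra_simps)

lemma brk_antisym: "brk \<beta> \<gamma> K = - brk \<gamma> \<beta> K"
  unfolding brk_def sum_3 by (simp add: algebra_simps)

text \<open>Generating function in \<open>x\<close>, \<open>y\<close> of the coefficients occurring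
  in the bracket. Since \<open>r + s + 1 - N \<le> N - 1\<close>, only dynamic coefficients
  enter.\<close>

definition kern :: "complex^3^3^'n::enum \<Rightarrow> complex \<Rightarrow> complex \<Rightarrow> 3 \<Rightarrow> 3 \<Rightarrow> complex" where
  "kern L x y i j = (\<Sum>r<CARD('n). \<Sum>s<CARD('n).
     if r + s + 1 < CARD('n) then 0 else x ^ r * y ^ s * Lcoef L (r + s + 1 - CARD('n)) $ i $ j)"

lemma bivector_ecov:
  "bivector L (ecov x \<beta>) (ecov y \<gamma>) = brk \<beta> \<gamma> (kern (L :: complex^3^3^'n::enum) x y)"
proof -
  let ?M = "\<lambda>r s i j. if r + s + 1 < CARD('n) then 0
    else x ^ r * y ^ s * Lcoef L (r + s + 1 - CARD('n)) $ i $ j"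
  have "bivector L (ecov x \<beta>) (ecov y \<gamma>)
      = (\<Sum>r<CARD('n). \<Sum>s<CARD('n). \<Sum>i\<in>UNIV. \<Sum>j\<in>UNIV. \<Sum>k\<in>UNIV. \<Sum>l\<in>UNIV.
        ecov x \<beta> r i j * ecov y \<gamma> s k l * coord_bracket L r i j s k l)"
    unfolding bivector_def
    by (rule sum.cong[OF refl], subst (2) sum.swap, rule sum.cong[OF refl], rule sum.swap)
  also have "\<dots> = (\<Sum>r<CARD('n). \<Sum>s<CARD('n). brk \<beta> \<gamma> (?M r s))"
    unfolding brk_def
    by (intro sum.cong refl) (simp add: ecov_def coord_bracket_def algebra_simps)
  also have "\<dots> = brk \<beta> \<gamma> (kern L x y)"
    unfolding kern_def by (simp add: brk_sum del: if_split)
  finally show ?thesis .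
qed

text \<open>The pairs \<open>(r, s)\<close> are sorted by the degree
  \<open>p = r + s + 1 - N\<close> of the coefficient they produce; with
  \<open>t = N - 1 - s\<close> one has \<open>r = p + t\<close>, and the inner sum is
  geometric.\<close>

lemma kern_eq:
  "kern (L :: complex^3^3^'n::enum) x y i j =
    (\<Sum>p<CARD('n). Lcoef L p $ i $ j * (\<Sum>t<CARD('n) - p. x ^ (p + t) * y ^ (CARD('n) - 1 - t)))"
proof -
  let ?N = "CARD('n)"
  let ?f = "\<lambda>r s. x ^ r * y ^ s * Lcoef L (r + s + 1 - ?N) $ i $ j"
  have "kern L x y i j = (\<Sum>(r, s)\<in>{..<?N} \<times> {..<?N}. if r + s + 1 < ?N then 0 else ?f r s)"
    unfolding kern_def by (rule sum.cartesian_product)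
  also have "\<dots> = (\<Sum>(r, s)\<in>{(r, s). r < ?N \<and> s < ?N \<and> ?N \<le> r + s + 1}. ?f r s)"
    by (rule sum.mono_neutral_cong_right) (auto split: if_splits)
  also have "\<dots> = (\<Sum>(p, t)\<in>Sigma {..<?N} (\<lambda>p. {..<?N - p}).
      Lcoef L p $ i $ j * (x ^ (p + t) * y ^ (?N - 1 - t)))"
    by (rule sum.reindex_bij_witness[where
          i = "\<lambda>(p, t). (p + t, ?N - 1 - t)" and j = "\<lambda>(r, s). (r + s + 1 - ?N, ?N - 1 - s)"])
      (auto simp: algebra_simps)
  also have "\<dots> = (\<Sum>p<?N. Lcoef L p $ i $ j * (\<Sum>t<?N - p. x ^ (p + t) * y ^ (?N - 1 - t)))"
    by (simp add: sum.Sigma[symmetric] sum_distrib_left)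
  finally show ?thesis .
qed

text \<open>The geometric sum gives \<open>x ^ N * y ^ p - y ^ N * x ^ p\<close>. This vanishes at
  \<open>p = N\<close>, so the leading coefficients may be added, turning \<open>ev\<close> into
  \<open>evL\<close>.\<close>

lemma kern_distinct:
  "(x - y) * kern (L :: complex^3^3^'n::enum) x y i j =
     x ^ CARD('n) * evL m q (pw y) L i j - y ^ CARD('n) * evL m q (pw x) L i j"
proof -
  let ?N = "CARD('n)"
  have A: "(x - y) * (\<Sum>t<?N - p. x ^ (p + t) * y ^ (?N - 1 - t)) = x ^ ?N * y ^ p - y ^ ?N * x ^ p"
    if "p < ?N" for p
  proof -
    obtain n where n: "?N = p + Suc n" using \<open>p < ?N\<close> less_imp_Suc_add by auto
    have "(\<Sum>t<?N - p. x ^ (p + t) * y ^ (?N - 1 - t))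
        = x ^ p * y ^ p * (\<Sum>t<Suc n. x ^ t * y ^ (n - t))"
      unfolding sum_distrib_left n
    proof (rule sum.cong)
      fix t assume "t \<in> {..<Suc n}"
      then have "p + Suc n - 1 - t = p + (n - t)" by simp
      then show "x ^ (p + t) * y ^ (p + Suc n - 1 - t) = x ^ p * y ^ p * (x ^ t * y ^ (n - t))"
        by (simp only: power_add mult_ac)
    qed simp
    then have "(x - y) * (\<Sum>t<?N - p. x ^ (p + t) * y ^ (?N - 1 - t))
        = x ^ p * y ^ p * (x ^ Suc n - y ^ Suc n)"
      unfolding diff_power_eq_sum by (simp only: mult_ac)
    then show ?thesis unfolding n by (simp add: power_add algebra_simps)
  qed
  have "(x - y) * kern L x y i j
      = (\<Sum>p<?N. Lcoef L p $ i $ j * (x ^ ?N * y ^ p - y ^ ?N * x ^ p))"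
    unfolding kern_eq
  proof (subst sum_distrib_left, intro sum.cong refl)
    fix p assume "p \<in> {..<?N}"
    then show "(x - y) * (Lcoef L p $ i $ j * (\<Sum>t<?N - p. x ^ (p + t) * y ^ (?N - 1 - t)))
        = Lcoef L p $ i $ j * (x ^ ?N * y ^ p - y ^ ?N * x ^ p)"
      using A[of p] by (subst mult.left_commute) simp
  qed
  then show ?thesis
    by (simp add: evL_def ev_def pw_def algebra_simps sum_subtractf sum_distrib_left)
qed

text \<open>The confluent case of the divided difference; again the contributions of the leading
  coefficient cancel.\<close>

lemma kern_same:
  "kern (L :: complex^3^3^'n::enum) x x i j =
     of_nat CARD('n) * x ^ (CARD('n) - 1) * evL m q (pw x) L i j - x ^ CARD('n) * evL m q (dpw x) L i j"
proof -
  let ?N = "CARD('n)"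
  have "(\<Sum>t<?N - p. x ^ (p + t) * x ^ (?N - 1 - t))
      = of_nat ?N * x ^ (?N - 1) * x ^ p - x ^ ?N * (of_nat p * x ^ (p - 1))"
    if "p < ?N" for p
  proof -
    have "(\<Sum>t<?N - p. x ^ (p + t) * x ^ (?N - 1 - t)) = (\<Sum>t<?N - p. x ^ (?N - 1 + p))"
      using that by (intro sum.cong refl) (auto simp: add.commute simp flip: power_add)
    also have "\<dots> = (of_nat ?N - of_nat p) * x ^ (?N - 1 + p)"
      using that by (simp add: of_nat_diff)
    also have "\<dots> = of_nat ?N * x ^ (?N - 1) * x ^ p - of_nat p * x ^ (?N - 1 + p)"
      by (simp only: power_add left_diff_distrib mult.assoc)
    also have "of_nat p * x ^ (?N - 1 + p) = x ^ ?N * (of_nat p * x ^ (p - 1))"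
    \<comment> \<open>For \<open>p = 0\<close>, where \<open>p - 1\<close> is truncated, the factor
      \<open>of_nat p\<close> makes both sides zero.\<close>
    proof (cases p)
      case (Suc p')
      have "?N - 1 + p = ?N + (p - 1)" using Suc that by simp
      then show ?thesis by (simp only: power_add mult_ac)
    qed simp
    finally show ?thesis .
  qed
  then have "kern L x x i j
      = (\<Sum>p<?N. Lcoef L p $ i $ j * (of_nat ?N * x ^ (?N - 1) * x ^ p - x ^ ?N * (of_nat p * x ^ (p - 1))))"
    unfolding kern_eq by (intro sum.cong refl) simp
  also have "\<dots> = of_nat ?N * x ^ (?N - 1) * evL m q (pw x) L i j - x ^ ?N * evL m q (dpw x) L i j"
    by (simp add: evL_def ev_def pw_def dpw_def algebra_simps sum_subtractf sum_distrib_left)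
  finally show ?thesis .
qed

text \<open>
  \<open>phi1\<close> and \<open>phi2\<close> are the gradients in \<open>E\<close> of \<open>(E 1 1 - w) * E 3 2 - E 1 2 * E 3 1\<close> and
  \<open>(E 2 2 - w) * E 3 1 - E 2 1 * E 3 2\<close>.  Their common zeros are the \<open>(E, w)\<close> for which
  \<open>(E 3 2, - E 3 1, 0)\<close> is a right eigenvector of \<open>E\<close> with eigenvalue \<open>w\<close>.
\<close>

definition phi1 :: "(3 \<Rightarrow> 3 \<Rightarrow> complex) \<Rightarrow> complex \<Rightarrow> 3 \<Rightarrow> 3 \<Rightarrow> complex" where
  "phi1 E w i j =
     (if i = 1 then (if j = 1 then E 3 2 else if j = 2 then - E 3 1 else 0)
      else if i = 3 then (if j = 1 then - E 1 2 else if j = 2 then E 1 1 - w else 0) else 0)"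

definition phi2 :: "(3 \<Rightarrow> 3 \<Rightarrow> complex) \<Rightarrow> complex \<Rightarrow> 3 \<Rightarrow> 3 \<Rightarrow> complex" where
  "phi2 E w i j =
     (if i = 2 then (if j = 1 then - E 3 2 else if j = 2 then E 3 1 else 0)
      else if i = 3 then (if j = 1 then E 2 2 - w else if j = 2 then - E 2 1 else 0) else 0)"

text \<open>These are the first two rows of the eigenvector equation; the third reads
  \<open>E 3 1 * E 3 2 - E 3 2 * E 3 1 = 0\<close> and always holds.\<close>

definition on_curve :: "(3 \<Rightarrow> 3 \<Rightarrow> complex) \<Rightarrow> complex \<Rightarrow> bool" where
  "on_curve E w \<longleftrightarrow> (E 1 1 - w) * E 3 2 = E 1 2 * E 3 1 \<and> (E 2 2 - w) * E 3 1 = E 2 1 * E 3 2"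

text \<open>Polynomial identities in all entries and in \<open>w\<close>, \<open>v\<close>. Both
  matrices are inserted because \<open>kern\<close> at distinct arguments is a combination of the
  two evaluations.\<close>

lemma brk_phi_same:
  "brk (phi1 E w) (phi1 F v) E = 0" "brk (phi1 E w) (phi1 F v) F = 0"
  "brk (phi2 E w) (phi2 F v) E = 0" "brk (phi2 E w) (phi2 F v) F = 0"
  by (simp_all add: brk_def sum_3 phi1_def phi2_def algebra_simps)

lemma brk_phi12:
  "brk (phi1 E w) (phi2 F v) X =
     E 3 1 * F 3 1 * X 1 2 - E 3 1 * F 3 2 * X 1 1 - E 3 2 * F 3 2 * X 2 1 + E 3 1 * F 3 2 * X 2 2
     + ((F 2 2 - v) * E 3 2 + (E 1 1 - w) * F 3 2) * X 3 1
     - ((F 2 2 - v) * E 3 1 + (E 1 1 - w) * F 3 1) * X 3 2"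
  by (simp add: brk_def sum_3 phi1_def phi2_def algebra_simps)

text \<open>The eigenvector equations at the point whose matrix is inserted make the mixed bracket
  vanish there.\<close>

lemma brk_phi12_left: "on_curve E w \<Longrightarrow> brk (phi1 E w) (phi2 F v) E = 0"
  unfolding brk_phi12 on_curve_def by algebra

lemma brk_phi12_right: "on_curve F v \<Longrightarrow> brk (phi1 E w) (phi2 F v) F = 0"
  unfolding brk_phi12 on_curve_def by algebra

text \<open>The source of the nonzero bracket: for \<open>X\<close> the derivative of the matrix
  polynomial in \<lambda>, the right side is minus the derivative of \<open>\<B>\<close>.\<close>

lemma brk_phi12_deriv: "on_curve E w \<Longrightarrow> brk (phi1 E w) (phi2 E w) X = - dBform E X"
  unfolding brk_phi12 on_curve_def dBform_def by algebra

text \<open>Identically \<open>\<B> = E 3 1 * F_1 - E 3 2 * F_2\<close>; at a common zero of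
  \<open>F_1\<close> and \<open>F_2\<close> the derivatives of the prefactors drop out.\<close>

lemma dBform_on_curve:
  "on_curve E w \<Longrightarrow> dBform E X = E 3 1 * dot (phi1 E w) X - E 3 2 * dot (phi2 E w) X"
  unfolding on_curve_def dBform_def dot_def phi1_def phi2_def sum_3 by simp algebra

section \<open>The variables of separation\<close>

lemma trace_evL:
  assumes "(L :: complex^3^3^'n::enum) \<in> phase_space"
  shows "evL m q c L 1 1 + evL m q c L 2 2 + evL m q c L 3 3 = 0"
proof -
  have t: "Lcoef L p $ 1 $ 1 + Lcoef L p $ 2 $ 2 + Lcoef L p $ 3 $ 3 = 0" for p
    using assms unfolding phase_space_def Lcoef_def trace_def sum_3 by blast
  have "ev c L 1 1 + ev c L 2 2 + ev c L 3 3
      = (\<Sum>p<CARD('n). c p * (Lcoef L p $ 1 $ 1 + Lcoef L p $ 2 $ 2 + Lcoef L p $ 3 $ 3))"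
    by (simp only: ev_def distrib_left sum.distrib)
  also have "\<dots> = 0" by (simp only: t) simp
  finally have e: "ev c L 1 1 + ev c L 2 2 + ev c L 3 3 = 0" .
  have l: "lead_coef m q $ 1 $ 1 + lead_coef m q $ 2 $ 2 + lead_coef m q $ 3 $ 3 = 0"
    by (simp add: lead_coef_eq vector_3 field_simps)
  show ?thesis unfolding evL_def using e l by algebra
qed

lemma poly_Lpoly: "poly (Lpoly m q L $ i $ j) z = evL m q (pw z) (L :: complex^3^3^'n::enum) i j"
  by (simp add: Leval_eq[symmetric] Leval_def)

lemma det_Leval_on_curve:
  fixes L :: "complex^3^3^'n::enum"
  assumes c: "on_curve (evL m q (pw z) L) w" and nz: "evL m q (pw z) L 3 2 \<noteq> 0"
  shows "det (Leval m q L z - mat w) = 0"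
proof -
  let ?E = "evL m q (pw z) L"
  \<comment> \<open>With the substitution below, the two factors \<open>a * h - b * g\<close> and
    \<open>e * g - d * h\<close> are \<open>F_1\<close> and \<open>F_2\<close>, so the determinant
    times \<open>h = E 3 2\<close> vanishes.\<close>
  have *: "(a * (e * k) + b * (f * g) + c * (d * h) - a * (f * h) - b * (d * k) - c * (e * g)) * h
      = (a * h - b * g) * (e * k - f * h) + (e * g - d * h) * (b * k - c * h)"
    for a b c d e f g h k :: complex
    by (simp add: algebra_simps)
  have "det (Leval m q L z - mat w) * ?E 3 2 = 0"
    unfolding det_3 using c *[of "?E 1 1 - w" "?E 2 2 - w" "?E 3 3 - w" "?E 1 2" "?E 2 3" "?E 3 1" "?E 1 3" "?E 2 1" "?E 3 2"]
    by (simp add: Leval_eq mat_def on_curve_def mult.assoc)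
  then show ?thesis using nz by simp
qed

text \<open>Newton's identities for a traceless matrix express the characteristic polynomial through
  the traces of the square and the cube. The factor 6 in the proof clears the denominators in
  \<open>I2\<close> and \<open>I3\<close>.\<close>

lemma det_Leval:
  fixes L :: "complex^3^3^'n::enum"
  assumes L: "L \<in> phase_space"
  shows "det (Leval m q L z - mat w) = - (w ^ 3 - w * poly (I2 m q L) z - poly (I3 m q L) z)"
proof -
  let ?E = "evL m q (pw z) L"
  have t: "?E 3 3 = - ?E 1 1 - ?E 2 2"
    using trace_evL[OF L, of m q "pw z"] by (simp add: algebra_simps eq_neg_iff_add_eq_0)
  have i2: "2 * poly (I2 m q L) z = (\<Sum>i\<in>UNIV. \<Sum>k\<in>UNIV. ?E i k * ?E k i)"
    by (simp add: I2_def trace_def matrix_matrix_mult_def poly_sum poly_Lpoly)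
  have i3: "3 * poly (I3 m q L) z = (\<Sum>i\<in>UNIV. \<Sum>k\<in>UNIV. (\<Sum>l\<in>UNIV. ?E i l * ?E l k) * ?E k i)"
    by (simp add: I3_def trace_def matrix_matrix_mult_def poly_sum poly_Lpoly)
  have "6 * det (Leval m q L z - mat w) = - (6 * w ^ 3 - 3 * w * (2 * poly (I2 m q L) z)
      - 2 * (3 * poly (I3 m q L) z))"
    unfolding i2 i3 det_3 sum_3 by (simp add: Leval_eq mat_def t algebra_simps power3_eq_cube)
  also have "\<dots> = 6 * (- (w ^ 3 - w * poly (I2 m q L) z - poly (I3 m q L) z))"
    by (simp add: algebra_simps)
  finally show ?thesis by (rule mult_left_cancel[THEN iffD1, rotated]) simp
qed

text \<open>The conditions \<open>lead\<close> give \<open>\<B>\<close> its full degree, so the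
  \<open>3 * CARD('n)\<close> distinct branches exhaust its roots.\<close>

locale separation =
  fixes m q :: real and U :: "(complex^3^3^'n::enum) set"
    and lam w :: "nat \<Rightarrow> complex^3^3^'n::enum \<Rightarrow> complex"
  assumes lead: "m \<noteq> 0" "m \<noteq> 3 * q" "m \<noteq> - 3 * q"
    and sep: "separation_variables m q U lam w"
begin

abbreviation "E k L \<equiv> evL m q (pw (lam k L)) L"
abbreviation "E' k L \<equiv> evL m q (dpw (lam k L)) L"
abbreviation "E'' k L \<equiv> evL m q (ddpw (lam k L)) L"
abbreviation "B' k L \<equiv> dBform (E k L) (E' k L)"

lemma U_phase_space: "L \<in> U \<Longrightarrow> L \<in> phase_space"
  using sep openin_imp_subset unfolding separation_variables_def by blast

lemma at_U: "L \<in> U \<Longrightarrow> at L within U = at L within phase_space"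
  using sep unfolding separation_variables_def by (intro at_within_openin) auto

lemma
  assumes "L \<in> U" "k < 3 * CARD('n)"
  shows E31: "E k L 3 1 \<noteq> 0" and E32: "E k L 3 2 \<noteq> 0" and Bform_0: "Bform (E k L) = 0"
    and w_eq: "w k L = E k L 1 1 - E k L 1 2 * E k L 3 1 / E k L 3 2"
  using sep assms unfolding separation_variables_def
  by (auto simp: Leval_eq poly_Bpoly Afun_def Let_def)

lemma on_curve: assumes "L \<in> U" "k < 3 * CARD('n)" shows "on_curve (E k L) (w k L)"
proof -
  let ?E = "E k L"
  have 1: "(?E 1 1 - w k L) * ?E 3 2 = ?E 1 2 * ?E 3 1"
    using E32[OF assms] by (simp add: w_eq[OF assms])
  \<comment> \<open>By \<open>\<B> = E 3 1 * F_1 - E 3 2 * F_2\<close> and \<open>F_1 = 0\<close>,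
    the vanishing of \<open>\<B>\<close> leaves \<open>E 3 2 * F_2 = 0\<close>.\<close>
  moreover have "((?E 2 2 - w k L) * ?E 3 1 - ?E 2 1 * ?E 3 2) * ?E 3 2 = 0"
    using 1 Bform_0[OF assms] unfolding Bform_def by algebra
  then have "(?E 2 2 - w k L) * ?E 3 1 = ?E 2 1 * ?E 3 2" using E32[OF assms] by simp
  ultimately show ?thesis by (simp add: on_curve_def)
qed

lemma Afun_eq_Afun': assumes "L \<in> U" "k < 3 * CARD('n)" shows "Afun m q L (lam k L) = Afun' m q L (lam k L)"
proof -
  have "w k L = Afun' m q L (lam k L)"
    using on_curve[OF assms] E31[OF assms]
    by (simp add: on_curve_def Afun'_def Let_def Leval_eq field_simps)
  then show ?thesis using w_eq[OF assms] by (simp add: Afun_def Let_def Leval_eq)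
qed

lemma spectral:
  assumes "L \<in> U" "k < 3 * CARD('n)"
  shows "(w k L, lam k L) \<in> spectral_curve m q L"
    and "w k L ^ 3 - w k L * poly (I2 m q L) (lam k L) - poly (I3 m q L) (lam k L) = 0"
proof -
  have d: "det (Leval m q L (lam k L) - mat (w k L)) = 0"
    by (intro det_Leval_on_curve on_curve E32 assms)
  then show "(w k L, lam k L) \<in> spectral_curve m q L" by (simp add: spectral_curve_def)
  show "w k L ^ 3 - w k L * poly (I2 m q L) (lam k L) - poly (I3 m q L) (lam k L) = 0"
    using d det_Leval[OF U_phase_space[OF assms(1)], of m q "lam k L" "w k L"] by simp
qed

lemma lam_inj: "L \<in> U \<Longrightarrow> inj_on (\<lambda>k. lam k L) {..<3 * CARD('n)}"
  using sep unfolding separation_variables_def by auto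

lemma B'_nonzero: assumes "L \<in> U" "k < 3 * CARD('n)" shows "B' k L \<noteq> 0"
proof -
  have "poly (pderiv (Bpoly m q L)) (lam k L) \<noteq> 0"
    by (rule poly_pderiv_nonzero_of_distinct_roots[OF degree_Bpoly[OF lead] _ lam_inj])
      (use assms Bform_0 in \<open>auto simp: poly_Bpoly\<close>)
  then show ?thesis by (simp add: poly_pderiv_Bpoly)
qed

section \<open>Differentials of the roots and of the eigenvalues\<close>

definition dlam :: "nat \<Rightarrow> complex^3^3^'n::enum \<Rightarrow> complex^3^3^'n::enum \<Rightarrow> complex" where
  "dlam k L V = - dBform (E k L) (ev (pw (lam k L)) V) / B' k L"

text \<open>Total variation of the matrix at the root: the matrix polynomial varies and its argument
  moves with the root.\<close>

definition dE :: "nat \<Rightarrow> complex^3^3^'n::enum \<Rightarrow> complex^3^3^'n::enum \<Rightarrow> 3 \<Rightarrow> 3 \<Rightarrow> complex" where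
  "dE k L V i j = ev (pw (lam k L)) V i j + dlam k L V * E' k L i j"

text \<open>The result of differentiating \<open>F_1 = 0\<close> along the branch and solving for
  the variation of \<open>w\<close>, which enters with the factor
  \<open>- E k L 3 2\<close>.\<close>

definition dw :: "nat \<Rightarrow> complex^3^3^'n::enum \<Rightarrow> complex^3^3^'n::enum \<Rightarrow> complex" where
  "dw k L V = dot (phi1 (E k L) (w k L)) (dE k L V) / E k L 3 2"

lemma lam_has_derivative:
  assumes "L \<in> U" "k < 3 * CARD('n)"
  shows "(lam k has_derivative dlam k L) (at L within phase_space)"
proof -
  let ?G = "\<lambda>(L, z). Bform (evL m q (pw z) (L :: complex^3^3^'n::enum))"
  let ?D = "\<lambda>(V, \<zeta>). dBform (E k L) (\<lambda>i j. ev (pw (lam k L)) V i j + \<zeta> * E' k L i j)"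
  have "((\<lambda>t. evL m q (pw (snd t)) (fst t) i j) has_derivative
      (\<lambda>h. ev (pw (snd (L, lam k L))) (fst h) i j + snd h * evL m q (dpw (lam k L)) (fst (L, lam k L)) i j))
      (at (L, lam k L))" for i j
    by (rule evL_has_derivative) (auto intro: pw_DERIV derivative_intros)
  from Bform_has_derivative[OF this]
  have G: "(?G has_derivative ?D) (at (L, lam k L))"
    by (simp add: split_def)
  have cont: "(lam k \<longlongrightarrow> lam k L) (at L within U)"
    using sep assms unfolding separation_variables_def continuous_on_def by blast
  have 0: "dBform M (ev c (0 :: complex^3^3^'n::enum)) = 0" for c M
    by (simp add: ev_def Lcoef_def dBform_def)
  have "(lam k has_derivative (\<lambda>v. - ?D (v, 0) / B' k L)) (at L within U)"
    by (rule implicit_has_derivative[OF G _ B'_nonzero[OF assms] cont _ assms(1)])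
      (use Bform_0 assms in \<open>auto simp: 0 dBform_linear\<close>)
  then show ?thesis by (simp add: at_U[OF assms(1)] dlam_def[abs_def])
qed

lemma E_has_derivative:
  assumes "L \<in> U" "k < 3 * CARD('n)"
  shows "((\<lambda>L. E k L i j) has_derivative (\<lambda>V. dE k L V i j)) (at L within phase_space)"
  unfolding dE_def
  by (rule evL_has_derivative[OF pw_DERIV lam_has_derivative[OF assms] has_derivative_ident])

lemma w_has_derivative:
  assumes "L \<in> U" "k < 3 * CARD('n)"
  shows "(w k has_derivative dw k L) (at L within phase_space)"
proof -
  let ?f = "\<lambda>L. E k L 1 1 - E k L 1 2 * E k L 3 1 / E k L 3 2"
  have nz: "E k L 3 2 \<noteq> 0" by (rule E32[OF assms])
  \<comment> \<open>Brings the quotient rule into the shape of the gradient \<open>phi1\<close>;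
    here \<open>b * c / d\<close> stands for \<open>E 1 1 - w\<close>.\<close>
  have q: "\<delta>1 - ((\<delta>2 * c + b * \<delta>3) * d - b * c * \<delta>4) / (d * d)
      = (d * \<delta>1 - c * \<delta>2 - b * \<delta>3 + b * c / d * \<delta>4) / d"
    if "d \<noteq> 0" for b c d \<delta>1 \<delta>2 \<delta>3 \<delta>4 :: complex
    using that by (simp add: field_simps)
  have "dw k L V = dE k L V 1 1
      - ((dE k L V 1 2 * E k L 3 1 + E k L 1 2 * dE k L V 3 1) * E k L 3 2
         - E k L 1 2 * E k L 3 1 * dE k L V 3 2) / (E k L 3 2 * E k L 3 2)" for V
    unfolding q[OF nz] by (simp add: dw_def dot_def sum_3 phi1_def w_eq[OF assms] del: times_divide_eq_left)
  then have dw: "dw k L = (\<lambda>V. dE k L V 1 1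
      - ((dE k L V 1 2 * E k L 3 1 + E k L 1 2 * dE k L V 3 1) * E k L 3 2
         - E k L 1 2 * E k L 3 1 * dE k L V 3 2) / (E k L 3 2 * E k L 3 2))" by blast
  have "(?f has_derivative dw k L) (at L within phase_space)"
    unfolding dw
    by (rule derivative_eq_intros E_has_derivative[OF assms] nz refl)+ (simp add: fun_eq_iff add.commute)
  then have "(?f has_derivative dw k L) (at L within U)"
    by (simp add: at_U[OF assms(1)])
  then have "(w k has_derivative dw k L) (at L within U)"
    by (rule has_derivative_transform[OF assms(1), rotated]) (rule w_eq[OF _ assms(2)])
  then show ?thesis by (simp add: at_U[OF assms(1)])
qed

text \<open>Coefficients of the differential of the root: \<open>dBform\<close> in
  \<open>dlam\<close> is replaced by its expression through \<open>phi1\<close> and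
  \<open>phi2\<close> on the curve.\<close>

definition alpha :: "nat \<Rightarrow> complex^3^3^'n::enum \<Rightarrow> 3 \<Rightarrow> 3 \<Rightarrow> complex" where
  "alpha k L i j = - E k L 3 1 / B' k L * phi1 (E k L) (w k L) i j
     + E k L 3 2 / B' k L * phi2 (E k L) (w k L) i j"

text \<open>Substituting \<open>alpha\<close> for the motion of the root in \<open>dw\<close>;
  \<open>c\<close> is the \<lambda>-derivative of \<open>F_1\<close> divided by that of
  \<open>\<B>\<close>. Both differentials are thus evaluations at the same point
  \<open>lam k L\<close>.\<close>

definition omega :: "nat \<Rightarrow> complex^3^3^'n::enum \<Rightarrow> 3 \<Rightarrow> 3 \<Rightarrow> complex" where
  "omega k L i j = (let c = dot (phi1 (E k L) (w k L)) (E' k L) / B' k L in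
     (1 / E k L 3 2 - c * E k L 3 1 / E k L 3 2) * phi1 (E k L) (w k L) i j
     + c * phi2 (E k L) (w k L) i j)"

lemma dot_comb: "dot (\<lambda>i j. a * \<beta> i j + b * \<gamma> i j) V = a * dot \<beta> V + b * dot \<gamma> V"
  "dot \<beta> (\<lambda>i j. W i j + b * V i j) = dot \<beta> W + b * dot \<beta> V"
  by (simp_all add: dot_def sum_3 algebra_simps)

lemma covector_alpha:
  assumes "L \<in> U" "k < 3 * CARD('n)"
  shows "covector (ecov (lam k L) (alpha k L)) = dlam k L"
proof
  fix V
  show "covector (ecov (lam k L) (alpha k L)) V = dlam k L V"
    unfolding covector_ecov alpha_def dlam_def dot_comb
      dBform_on_curve[OF on_curve[OF assms], of "ev (pw (lam k L)) V"]
    by (simp add: field_simps B'_nonzero[OF assms])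
qed

lemma covector_omega:
  assumes "L \<in> U" "k < 3 * CARD('n)"
  shows "covector (ecov (lam k L) (omega k L)) = dw k L"
proof
  fix V
  have a: "dlam k L V = (E k L 3 2 * dot (phi2 (E k L) (w k L)) (ev (pw (lam k L)) V)
      - E k L 3 1 * dot (phi1 (E k L) (w k L)) (ev (pw (lam k L)) V)) / B' k L"
    unfolding dlam_def dBform_on_curve[OF on_curve[OF assms], of "ev (pw (lam k L)) V"] by simp
  have q: "(1 / e - c / b * f / e) * x + c / b * y = (x + (e * y - f * x) / b * c) / e"
    if "b \<noteq> 0" "e \<noteq> 0" for b c e f x y :: complex
    using that by (simp add: field_simps)
  show "covector (ecov (lam k L) (omega k L)) V = dw k L V"
    unfolding covector_ecov omega_def dw_def dE_def dot_comb Let_def a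
    by (rule q[OF B'_nonzero[OF assms] E32[OF assms]])
qed

lemma has_differential_lam:
  "L \<in> U \<Longrightarrow> k < 3 * CARD('n) \<Longrightarrow> has_differential (lam k) (ecov (lam k L) (alpha k L)) L"
  by (simp add: has_differential_def covector_alpha lam_has_derivative)

lemma has_differential_w:
  "L \<in> U \<Longrightarrow> k < 3 * CARD('n) \<Longrightarrow> has_differential (w k) (ecov (lam k L) (omega k L)) L"
  by (simp add: has_differential_def covector_omega w_has_derivative)

section \<open>Brackets of the separation variables\<close>

lemma brk_kern_distinct:
  assumes "x \<noteq> y" "brk \<beta> \<gamma> (evL m q (pw x) L) = 0" "brk \<beta> \<gamma> (evL m q (pw y) L) = 0"
  shows "brk \<beta> \<gamma> (kern (L :: complex^3^3^'n::enum) x y) = 0"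
proof -
  have "(x - y) * brk \<beta> \<gamma> (kern L x y) = brk \<beta> \<gamma> (\<lambda>i j. (x - y) * kern L x y i j)"
    by (rule brk_scale[symmetric])
  also have "\<dots> = 0"
    unfolding kern_distinct[of x y L _ _ m q] brk_diff brk_scale using assms by simp
  finally show ?thesis using assms(1) by simp
qed

lemma brk_kern_same:
  assumes "brk \<beta> \<gamma> (evL m q (pw x) L) = 0"
  shows "brk \<beta> \<gamma> (kern (L :: complex^3^3^'n::enum) x x) = - (x ^ CARD('n)) * brk \<beta> \<gamma> (evL m q (dpw x) L)"
  unfolding kern_same[of L x _ _ m q, abs_def] brk_diff brk_scale using assms by simp

text \<open>At distinct roots \<open>kern\<close> is a combination of \<open>E k L\<close> and
  \<open>E l L\<close>, on both of which \<open>brk\<close> vanishes. At equal roots only the term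
  with the \<lambda>-derivative survives, and it produces \<open>B' k L\<close>.\<close>

lemma brk_phi_kern:
  assumes L: "L \<in> U" and k: "k < 3 * CARD('n)" and l: "l < 3 * CARD('n)"
  defines "K \<equiv> kern L (lam k L) (lam l L)"
  shows "brk (phi1 (E k L) (w k L)) (phi1 (E l L) (w l L)) K = 0"
    and "brk (phi2 (E k L) (w k L)) (phi2 (E l L) (w l L)) K = 0"
    and "brk (phi1 (E k L) (w k L)) (phi2 (E l L) (w l L)) K
      = (if k = l then lam k L ^ CARD('n) * B' k L else 0)"
    and "brk (phi2 (E k L) (w k L)) (phi1 (E l L) (w l L)) K
      = (if k = l then - (lam k L ^ CARD('n)) * B' k L else 0)"
proof -
  note ck = on_curve[OF L k] and cl = on_curve[OF L l]
  have "brk (phi1 (E k L) (w k L)) (phi1 (E l L) (w l L)) K = 0 \<and>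
     brk (phi2 (E k L) (w k L)) (phi2 (E l L) (w l L)) K = 0 \<and>
     brk (phi1 (E k L) (w k L)) (phi2 (E l L) (w l L)) K
      = (if k = l then lam k L ^ CARD('n) * B' k L else 0) \<and>
     brk (phi2 (E k L) (w k L)) (phi1 (E l L) (w l L)) K
      = (if k = l then - (lam k L ^ CARD('n)) * B' k L else 0)"
  proof (cases "k = l")
    case False
    then have ne: "lam k L \<noteq> lam l L" using lam_inj[OF L] k l by (auto dest: inj_onD)
    have 21: "brk (phi2 (E k L) (w k L)) (phi1 (E l L) (w l L)) (E k L) = 0"
      "brk (phi2 (E k L) (w k L)) (phi1 (E l L) (w l L)) (E l L) = 0"
      by (subst brk_antisym, simp add: brk_phi12_right[OF ck],
          subst brk_antisym, simp add: brk_phi12_left[OF cl])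
    show ?thesis
      unfolding K_def using False
      by (auto intro!: brk_kern_distinct[OF ne] brk_phi_same brk_phi12_left[OF ck]
          brk_phi12_right[OF cl] 21)
  next
    case True
    have z: "brk \<beta> \<beta> M = 0" for \<beta> M using brk_antisym[of \<beta> \<beta> M] by simp
    have "brk (phi1 (E k L) (w k L)) (phi2 (E k L) (w k L)) K = lam k L ^ CARD('n) * B' k L"
      unfolding K_def True[symmetric] brk_kern_same[OF brk_phi12_left[OF ck]]
      by (simp add: brk_phi12_deriv[OF ck])
    then show ?thesis
      using True z brk_antisym[of "phi2 (E k L) (w k L)" "phi1 (E k L) (w k L)" K] by simp
  qed
  then show "brk (phi1 (E k L) (w k L)) (phi1 (E l L) (w l L)) K = 0"
    and "brk (phi2 (E k L) (w k L)) (phi2 (E l L) (w l L)) K = 0"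
    and "brk (phi1 (E k L) (w k L)) (phi2 (E l L) (w l L)) K
      = (if k = l then lam k L ^ CARD('n) * B' k L else 0)"
    and "brk (phi2 (E k L) (w k L)) (phi1 (E l L) (w l L)) K
      = (if k = l then - (lam k L ^ CARD('n)) * B' k L else 0)" by auto
qed

text \<open>Both differentials are combinations of \<open>phi1\<close> and \<open>phi2\<close>, so
  at equal roots each bracket is the determinant of their coefficients times
  \<open>lam k L ^ CARD('n) * B' k L\<close>. For \<open>alpha\<close> against \<open>omega\<close>
  this determinant is \<open>- 1 / B' k L\<close>.\<close>

lemma
  assumes L: "L \<in> U" and k: "k < 3 * CARD('n)" and l: "l < 3 * CARD('n)"
  shows bivector_lam_lam:
      "bivector L (ecov (lam k L) (alpha k L)) (ecov (lam l L) (alpha l L)) = 0"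
    and bivector_lam_w:
      "bivector L (ecov (lam k L) (alpha k L)) (ecov (lam l L) (omega l L))
        = - (lam k L ^ CARD('n)) * (if k = l then 1 else 0)"
    and bivector_w_w:
      "bivector L (ecov (lam k L) (omega k L)) (ecov (lam l L) (omega l L)) = 0"
proof -
  define b where "b = B' k L"
  define e f where "e = E k L 3 2" and "f = E k L 3 1"
  define c where "c = dot (phi1 (E k L) (w k L)) (E' k L) / B' k L"
  have nz: "b \<noteq> 0" "e \<noteq> 0" using B'_nonzero[OF L k] E32[OF L k] by (simp_all add: b_def e_def)
  let ?x = "lam k L ^ CARD('n)"
  have a: "brk (\<lambda>i j. p * phi1 (E k L) (w k L) i j + r * phi2 (E k L) (w k L) i j)
      (\<lambda>i j. p' * phi1 (E l L) (w l L) i j + r' * phi2 (E l L) (w l L) i j)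
      (kern L (lam k L) (lam l L)) = (if k = l then (p * r' - r * p') * (?x * b) else 0)" for p r p' r'
    unfolding brk_comb_left brk_comb_right brk_phi_kern[OF L k l] b_def
    by (simp add: algebra_simps)
  show "bivector L (ecov (lam k L) (alpha k L)) (ecov (lam l L) (alpha l L)) = 0"
    unfolding bivector_ecov alpha_def[abs_def] a by simp
  show "bivector L (ecov (lam k L) (omega k L)) (ecov (lam l L) (omega l L)) = 0"
    unfolding bivector_ecov omega_def[abs_def] a Let_def by simp
  have "(- f / b * c - e / b * (1 / e - c * f / e)) * (?x * b) = - ?x"
    using nz by (simp add: field_simps)
  then show "bivector L (ecov (lam k L) (alpha k L)) (ecov (lam l L) (omega l L))
        = - (lam k L ^ CARD('n)) * (if k = l then 1 else 0)"
    unfolding bivector_ecov alpha_def[abs_def] omega_def[abs_def] a Let_def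
    by (cases "k = l") (simp_all add: b_def c_def e_def f_def)
qed

end

section \<open>The exterior derivative of the Liouville form\<close>

context separation
begin

text \<open>The quotient rule for \<open>dlam k L v\<close> in the direction \<open>u\<close>, with
  \<open>v\<close> held fixed.\<close>

definition d2lam :: "nat \<Rightarrow> complex^3^3^'n::enum \<Rightarrow> complex^3^3^'n::enum \<Rightarrow> complex^3^3^'n::enum \<Rightarrow> complex" where
  "d2lam k L u v =
    - ((ddBform (E k L) (dE k L u) (ev (pw (lam k L)) v)
        + dlam k L u * dBform (E k L) (ev (dpw (lam k L)) v)) * B' k L
      - dBform (E k L) (ev (pw (lam k L)) v)
        * (ddBform (E k L) (dE k L u) (E' k L)
           + (dBform (E k L) (ev (dpw (lam k L)) u) + dlam k L u * dBform (E k L) (E'' k L))))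
    / (B' k L * B' k L)"

lemma dlam_has_derivative:
  assumes "L \<in> U" "k < 3 * CARD('n)"
  shows "((\<lambda>L. dlam k L v) has_derivative (\<lambda>u. d2lam k L u v)) (at L within phase_space)"
proof -
  note E = E_has_derivative[OF assms] and l = lam_has_derivative[OF assms]
  have v: "((\<lambda>L. ev (pw (lam k L)) v i j) has_derivative
      (\<lambda>u. dlam k L u * ev (dpw (lam k L)) v i j)) (at L within phase_space)" for i j
    by (rule ev_has_derivative[OF pw_DERIV l])
  have E': "((\<lambda>L. E' k L i j) has_derivative
      (\<lambda>u. ev (dpw (lam k L)) u i j + dlam k L u * E'' k L i j)) (at L within phase_space)" for i j
    by (rule evL_has_derivative[OF dpw_DERIV l has_derivative_ident])
  show ?thesis
    unfolding dlam_def
    by (rule has_derivative_eq_rhs[OF has_derivative_divide'[OF has_derivative_minus[OF dBform_has_derivative[OF E v]]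
          dBform_has_derivative[OF E E'] B'_nonzero[OF assms]]])
      (simp add: fun_eq_iff d2lam_def dBform_linear algebra_simps flip: add_divide_distrib diff_divide_distrib)
qed

lemma d2lam_sym:
  assumes "L \<in> U" "k < 3 * CARD('n)"
  shows "d2lam k L u v = d2lam k L v u"
proof -
  have dE: "ddBform (E k L) (dE k L u) X
      = ddBform (E k L) (ev (pw (lam k L)) u) X + dlam k L u * ddBform (E k L) (E' k L) X" for u X
    unfolding dE_def[abs_def] ddBform_linear ..
  define b where "b = B' k L"
  have b: "b \<noteq> 0" using B'_nonzero[OF assms] by (simp add: b_def)
  \<comment> \<open>Expressing these terms through \<open>dlam\<close> makes the second derivative
    visibly symmetric, up to the symmetry of \<open>ddBform\<close>.\<close>
  have X: "dBform (E k L) (ev (pw (lam k L)) u) = - b * dlam k L u" for u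
    using b by (simp add: dlam_def b_def)
  have "d2lam k L u v =
    - ((ddBform (E k L) (ev (pw (lam k L)) u) (ev (pw (lam k L)) v)
        + dlam k L u * ddBform (E k L) (E' k L) (ev (pw (lam k L)) v)
        + dlam k L v * ddBform (E k L) (E' k L) (ev (pw (lam k L)) u)
        + dlam k L u * dBform (E k L) (ev (dpw (lam k L)) v)
        + dlam k L v * dBform (E k L) (ev (dpw (lam k L)) u)
        + dlam k L u * dlam k L v * (ddBform (E k L) (E' k L) (E' k L) + dBform (E k L) (E'' k L))) * b)
    / (b * b)" for u v
    unfolding d2lam_def b_def[symmetric] X dE ddBform_sym[of "E k L" "ev (pw (lam k L)) u" "E' k L"]
    by (simp add: algebra_simps)
  then show ?thesis
    by (simp add: ddBform_sym[of "E k L" "ev (pw (lam k L)) u" "ev (pw (lam k L)) v"] algebra_simps)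
qed

definition dOmega :: "complex^3^3^'n::enum \<Rightarrow> complex^3^3^'n::enum \<Rightarrow> complex^3^3^'n::enum \<Rightarrow> complex" where
  "dOmega L v u = - (\<Sum>k<3 * CARD('n).
     (deriv (\<lambda>z. inverse (z ^ CARD('n))) (lam k L) * dlam k L u * w k L
        + inverse (lam k L ^ CARD('n)) * dw k L u) * dlam k L v
     + inverse (lam k L ^ CARD('n)) * w k L * d2lam k L u v)"

lemma Omega_has_derivative:
  assumes L: "L \<in> U" and nz: "\<forall>k<3 * CARD('n). lam k L \<noteq> 0" and v: "v \<in> phase_space"
  shows "((\<lambda>L. Omega lam w L v) has_derivative dOmega L v) (at L within phase_space)"
proof -
  let ?c = "\<lambda>z. inverse (z ^ CARD('n)) :: complex"
  let ?f = "\<lambda>L. - (\<Sum>k<3 * CARD('n). ?c (lam k L) * w k L * dlam k L v)"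
  have "((\<lambda>L. ?c (lam k L) * w k L * dlam k L v) has_derivative
      (\<lambda>u. (deriv ?c (lam k L) * dlam k L u * w k L + ?c (lam k L) * dw k L u) * dlam k L v
        + ?c (lam k L) * w k L * d2lam k L u v)) (at L within phase_space)"
    if k: "k < 3 * CARD('n)" for k
  proof -
    have "?c field_differentiable at (lam k L)"
      using nz k by (intro derivative_intros) auto
    then have "(?c has_derivative (\<lambda>h. deriv ?c (lam k L) * h)) (at (lam k L))"
      by (simp add: DERIV_deriv_iff_field_differentiable has_field_derivative_def[symmetric])
    from has_derivative_compose[OF lam_has_derivative[OF L k] this]
    have c: "((\<lambda>L. ?c (lam k L)) has_derivative (\<lambda>u. deriv ?c (lam k L) * dlam k L u))
        (at L within phase_space)" .
    show ?thesis
      by (rule has_derivative_eq_rhs[OF has_derivative_mult[OF has_derivative_mult[OF c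
              w_has_derivative[OF L k]] dlam_has_derivative[OF L k]]])
        (simp add: fun_eq_iff algebra_simps)
  qed
  then have "(?f has_derivative dOmega L v) (at L within phase_space)"
    unfolding dOmega_def by (intro has_derivative_minus has_derivative_sum) auto
  then have "(?f has_derivative dOmega L v) (at L within U)" by (simp add: at_U[OF L])
  \<comment> \<open>As \<open>v\<close> lies in \<open>phase_space\<close>, the chosen derivative
    inside \<open>Omega\<close> has the value \<open>dlam\<close> at every point of
    \<open>U\<close>.\<close>
  moreover have "Omega lam w L' v = ?f L'" if "L' \<in> U" for L'
    unfolding Omega_def
    by (intro arg_cong[of _ _ uminus] sum.cong refl)
      (use that v in \<open>simp add: power_int_minus differential_eq[OF lam_has_derivative] U_phase_space\<close>)
  ultimately have "((\<lambda>L. Omega lam w L v) has_derivative dOmega L v) (at L within U)"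
    using has_derivative_transform[OF L, of "\<lambda>L. Omega lam w L v" ?f] by blast
  then show ?thesis by (simp add: at_U[OF L])
qed

text \<open>The terms with \<open>d2lam\<close> and those with the derivative of the inverse power
  are symmetric in \<open>u\<close> and \<open>v\<close> and cancel; only the mixed products of
  \<open>dw\<close> and \<open>dlam\<close> remain.\<close>

lemma ext_deriv_Omega:
  assumes L: "L \<in> U" and nz: "\<forall>k<3 * CARD('n). lam k L \<noteq> 0"
    and u: "u \<in> phase_space" and v: "v \<in> phase_space"
  shows "ext_deriv (Omega lam w) L u v =
    - (\<Sum>k<3 * CARD('n). inverse (lam k L ^ CARD('n)) * (dw k L u * dlam k L v - dw k L v * dlam k L u))"
proof -
  have "ext_deriv (Omega lam w) L u v = dOmega L v u - dOmega L u v"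
    unfolding ext_deriv_def
    by (simp add: differential_eq[OF Omega_has_derivative[OF L nz]] u v U_phase_space[OF L])
  also have "\<dots> = - (\<Sum>k<3 * CARD('n).
      inverse (lam k L ^ CARD('n)) * (dw k L u * dlam k L v - dw k L v * dlam k L u))"
    unfolding dOmega_def minus_diff_minus sum_subtractf[symmetric]
    by (intro arg_cong[of _ _ uminus] sum.cong refl)
      (simp add: d2lam_sym[OF L, of _ v u] algebra_simps)
  finally show ?thesis .
qed

end

section \<open>The symplectic form\<close>

text \<open>Complex scaling, kept apart from \<open>scaleR\<close> because
  \<open>phase_space\<close> and the tangent spaces are only real subspaces.\<close>

definition cscale :: "complex \<Rightarrow> complex^3^3^'n::enum \<Rightarrow> complex^3^3^'n::enum" where
  "cscale c V = (\<chi> p i j. c * V $ p $ i $ j)"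

lemma Lcoef_linear [simp]:
  "Lcoef (cscale c V) p $ i $ j = c * Lcoef (V :: complex^3^3^'n::enum) p $ i $ j"
  "Lcoef (V + W) p $ i $ j = Lcoef V p $ i $ j + Lcoef (W :: complex^3^3^'n::enum) p $ i $ j"
  "Lcoef (0 :: complex^3^3^'n::enum) p $ i $ j = 0"
  by (simp_all add: Lcoef_def cscale_def)

lemma scaleR_eq_cscale: "r *\<^sub>R V = cscale (of_real r) (V :: complex^3^3^'n::enum)"
  by (simp add: cscale_def vec_eq_iff) (simp add: scaleR_conv_of_real)

lemma length_enum: "length (Enum.enum :: 'n::enum list) = CARD('n)"
  by (metis UNIV_enum distinct_card enum_distinct)

lemma enum_index: obtains s where "s < CARD('n::enum)" "(p::'n) = Enum.enum ! s"
  by (metis UNIV_I UNIV_enum in_set_conv_nth length_enum)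

lemma ex_Lcoef: "\<exists>V :: complex^3^3^'n::enum. \<forall>s<CARD('n). Lcoef V s = f s"
proof -
  have "\<forall>p::'n. \<exists>s. s < CARD('n) \<and> p = Enum.enum ! s" by (metis enum_index)
  then obtain idx where idx: "\<And>p::'n. idx p < CARD('n) \<and> p = Enum.enum ! idx p" by metis
  have "idx (Enum.enum ! s) = s" if "s < CARD('n)" for s
    using idx[of "Enum.enum ! s"] that
    by (metis enum_distinct length_enum nth_eq_iff_index_eq)
  then have "\<forall>s<CARD('n). Lcoef ((\<chi> p. f (idx p)) :: complex^3^3^'n::enum) s = f s"
    by (simp add: Lcoef_def)
  then show ?thesis by blast
qed

lemma sum_swap3:
  fixes h :: "'x \<Rightarrow> 'd \<Rightarrow> 'e \<Rightarrow> 'f \<Rightarrow> 'g::comm_monoid_add"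
  shows "(\<Sum>x\<in>X. \<Sum>d\<in>D. \<Sum>e\<in>E. \<Sum>f\<in>F. h x d e f)
    = (\<Sum>d\<in>D. \<Sum>e\<in>E. \<Sum>f\<in>F. \<Sum>x\<in>X. h x d e f)"
  by (subst sum.swap, rule sum.cong[OF refl], subst sum.swap, rule sum.cong[OF refl],
      rule sum.swap)

lemma sum3_swap3:
  fixes g :: "'a \<Rightarrow> 'b \<Rightarrow> 'c \<Rightarrow> 'd \<Rightarrow> 'e \<Rightarrow> 'f \<Rightarrow> 'g::comm_monoid_add"
  shows "(\<Sum>a\<in>A. \<Sum>b\<in>B. \<Sum>c\<in>C. \<Sum>d\<in>D. \<Sum>e\<in>E. \<Sum>f\<in>F. g a b c d e f)
    = (\<Sum>d\<in>D. \<Sum>e\<in>E. \<Sum>f\<in>F. \<Sum>a\<in>A. \<Sum>b\<in>B. \<Sum>c\<in>C. g a b c d e f)"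
proof -
  have "(\<Sum>a\<in>A. \<Sum>b\<in>B. \<Sum>c\<in>C. \<Sum>d\<in>D. \<Sum>e\<in>E. \<Sum>f\<in>F. g a b c d e f)
      = (\<Sum>a\<in>A. \<Sum>b\<in>B. \<Sum>d\<in>D. \<Sum>e\<in>E. \<Sum>f\<in>F. \<Sum>c\<in>C. g a b c d e f)"
    by (intro sum.cong refl sum_swap3)
  also have "\<dots> = (\<Sum>a\<in>A. \<Sum>d\<in>D. \<Sum>e\<in>E. \<Sum>f\<in>F. \<Sum>b\<in>B. \<Sum>c\<in>C. g a b c d e f)"
    by (intro sum.cong refl sum_swap3)
  also have "\<dots> = (\<Sum>d\<in>D. \<Sum>e\<in>E. \<Sum>f\<in>F. \<Sum>a\<in>A. \<Sum>b\<in>B. \<Sum>c\<in>C. g a b c d e f)"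
    by (rule sum_swap3)
  finally show ?thesis .
qed

subsection \<open>Hamiltonian vectors\<close>

lemma ex_hamiltonian_vector: "\<exists>V. hamiltonian_vector (L :: complex^3^3^'n::enum) a V"
proof -
  let ?f = "\<lambda>s. \<chi> k l. \<Sum>r<CARD('n). \<Sum>i\<in>UNIV. \<Sum>j\<in>UNIV. a r i j * coord_bracket L r i j s k l"
  obtain V :: "complex^3^3^'n::enum" where "\<forall>s<CARD('n). Lcoef V s = ?f s"
    using ex_Lcoef[of ?f] by blast
  then have "hamiltonian_vector L a V" unfolding hamiltonian_vector_def by simp
  then show ?thesis ..
qed

lemma hamiltonian_vector_add:
  "hamiltonian_vector L a V \<Longrightarrow> hamiltonian_vector L b W \<Longrightarrow>
    hamiltonian_vector L (\<lambda>r i j. a r i j + b r i j) (V + W :: complex^3^3^'n::enum)"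
  by (simp add: hamiltonian_vector_def distrib_right sum.distrib)

lemma hamiltonian_vector_cscale:
  "hamiltonian_vector L a V \<Longrightarrow>
    hamiltonian_vector L (\<lambda>r i j. c * a r i j) (cscale c V :: complex^3^3^'n::enum)"
  by (simp add: hamiltonian_vector_def sum_distrib_left mult.assoc)

text \<open>Hence the bracket depends on \<open>a\<close> only through its Hamiltonian vector, which
  makes \<open>symplectic_form\<close> independent of the chosen covectors.\<close>

lemma covector_hamiltonian:
  assumes "hamiltonian_vector (L :: complex^3^3^'n::enum) a V"
  shows "covector b V = bivector L a b"
proof -
  have "covector b V = (\<Sum>s<CARD('n). \<Sum>k\<in>UNIV. \<Sum>l\<in>UNIV. b s k l *
      (\<Sum>r<CARD('n). \<Sum>i\<in>UNIV. \<Sum>j\<in>UNIV. a r i j * coord_bracket L r i j s k l))"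
    unfolding covector_def using assms by (intro sum.cong refl) (simp add: hamiltonian_vector_def)
  also have "\<dots> = (\<Sum>s<CARD('n). \<Sum>k\<in>UNIV. \<Sum>l\<in>UNIV. \<Sum>r<CARD('n). \<Sum>i\<in>UNIV. \<Sum>j\<in>UNIV.
      a r i j * b s k l * coord_bracket L r i j s k l)"
    unfolding sum_distrib_left by (intro sum.cong refl) (simp only: mult_ac)
  also have "\<dots> = bivector L a b"
    unfolding bivector_def by (rule sum3_swap3)
  finally show ?thesis .
qed

text \<open>The trace is central in gl(3): contracting the second index pair of
  \<open>coord_bracket\<close> gives zero.\<close>

lemma trace_hamiltonian:
  assumes "hamiltonian_vector (L :: complex^3^3^'n::enum) a V"
  shows "trace (V $ p) = 0"
proof -
  obtain s where s: "s < CARD('n)" "p = Enum.enum ! s" by (rule enum_index)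
  have c: "(\<Sum>k\<in>UNIV. coord_bracket L r i j s k k) = 0" for r i j
    by (cases "r + s + 1 < CARD('n)") (simp_all add: coord_bracket_def sum_subtractf)
  have "trace (V $ p) = (\<Sum>k\<in>UNIV. Lcoef V s $ k $ k)"
    by (simp add: trace_def Lcoef_def s)
  also have "\<dots> = (\<Sum>k\<in>UNIV. \<Sum>r<CARD('n). \<Sum>i\<in>UNIV. \<Sum>j\<in>UNIV. a r i j * coord_bracket L r i j s k k)"
    using assms s by (simp add: hamiltonian_vector_def)
  also have "\<dots> = (\<Sum>r<CARD('n). \<Sum>i\<in>UNIV. \<Sum>j\<in>UNIV. a r i j * (\<Sum>k\<in>UNIV. coord_bracket L r i j s k k))"
    unfolding sum_distrib_left
    by (subst sum.swap, rule sum.cong[OF refl], subst sum.swap, rule sum.cong[OF refl], rule sum.swap)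
  finally show ?thesis by (simp add: c)
qed

subsection \<open>Casimir functions\<close>

definition Vpoly :: "complex^3^3^'n::enum \<Rightarrow> complex poly^3^3" where
  "Vpoly V = (\<chi> i j. \<Sum>p<CARD('n). monom (Lcoef V p $ i $ j) p)"

lemma coeff_Vpoly:
  "coeff (Vpoly V $ i $ j) p = (if p < CARD('n) then Lcoef (V :: complex^3^3^'n::enum) p $ i $ j else 0)"
  by (simp add: Vpoly_def coeff_sum)

text \<open>For \<open>Q = P\<close> and \<open>Q = P ** P\<close>, where \<open>P\<close> is the matrix polynomial of \<open>L\<close>, these are the
  differentials at \<open>L\<close> of the coefficients of \<open>I2\<close> and \<open>I3\<close>.\<close>

definition casD :: "complex poly^3^3 \<Rightarrow> nat \<Rightarrow> complex^3^3^'n::enum \<Rightarrow> complex" where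
  "casD Q j V = coeff (trace (Q ** Vpoly V)) j"

lemma casD_sum:
  assumes "j < CARD('n)"
  shows "casD Q j (V :: complex^3^3^'n::enum)
    = (\<Sum>i\<in>UNIV. \<Sum>k\<in>UNIV. \<Sum>s\<le>j. coeff (Q $ i $ k) (j - s) * Lcoef V s $ k $ i)"
proof -
  have "casD Q j V = (\<Sum>i\<in>UNIV. \<Sum>k\<in>UNIV. coeff (Vpoly V $ k $ i * Q $ i $ k) j)"
    by (simp add: casD_def trace_def matrix_matrix_mult_def coeff_sum mult.commute)
  moreover have "coeff (Vpoly V $ k $ i * Q $ i $ k) j
      = (\<Sum>s\<le>j. coeff (Q $ i $ k) (j - s) * Lcoef V s $ k $ i)" for i k
    unfolding coeff_mult using assms by (intro sum.cong refl) (simp add: coeff_Vpoly)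
  ultimately show ?thesis by simp
qed

lemma casD_linear:
  assumes "j < CARD('n)"
  shows "casD Q j (V + cscale c W :: complex^3^3^'n::enum) = casD Q j V + c * casD Q j W"
    and "casD Q j (0 :: complex^3^3^'n::enum) = 0"
  by (simp_all add: casD_sum assms distrib_left sum.distrib sum_distrib_left mult_ac)

text \<open>Contracting the gradient with the bracket against a coordinate of degree
  \<open>r\<close> yields the coefficient of degree \<open>r + j + 1 - N\<close> of the commutator
  of \<open>Q\<close> with the matrix polynomial.\<close>

lemma casD_hamiltonian:
  fixes L :: "complex^3^3^'n::enum"
  assumes comm: "Q ** Lpoly m q L = Lpoly m q L ** Q" and j: "j < CARD('n)"
    and V: "hamiltonian_vector L a V"
  shows "casD Q j V = 0"
proof -
  let ?P = "Lpoly m q L" and ?N = "CARD('n)"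
  have Z: "(\<Sum>i\<in>UNIV. \<Sum>k\<in>UNIV. \<Sum>s\<le>j. coeff (Q $ i $ k) (j - s) * coord_bracket L r b d s k i) = 0"
    if r: "r < ?N" for r b d
  proof (cases "r + j + 1 < ?N")
    case True
    then show ?thesis by (intro sum.neutral ballI) (auto simp: coord_bracket_def)
  next
    case False
    define M where "M = r + j + 1 - ?N"
    have "(\<Sum>i\<in>UNIV. \<Sum>k\<in>UNIV. \<Sum>s\<le>j. coeff (Q $ i $ k) (j - s) * coord_bracket L r b d s k i)
      = (\<Sum>s\<le>j. \<Sum>i\<in>UNIV. \<Sum>k\<in>UNIV. coeff (Q $ i $ k) (j - s) * coord_bracket L r b d s k i)"
      by (subst sum.swap[of _ "{..j}"], intro sum.cong refl sum.swap)
    also have "\<dots> = (\<Sum>s\<in>{?N - 1 - r..j}. \<Sum>i\<in>UNIV. \<Sum>k\<in>UNIV.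
        coeff (Q $ i $ k) (j - s) * coord_bracket L r b d s k i)"
      by (rule sum.mono_neutral_right) (auto simp: coord_bracket_def intro!: sum.neutral)
    also have "\<dots> = (\<Sum>t\<le>M. \<Sum>i\<in>UNIV. \<Sum>k\<in>UNIV.
        coeff (Q $ i $ k) (M - t) * ((if b = i then coeff (?P $ k $ d) t else 0)
          - (if k = d then coeff (?P $ b $ i) t else 0)))"
    \<comment> \<open>The new index \<open>t = r + s + 1 - N\<close> is the degree of the
      coefficient of \<open>L\<close>. As \<open>t \<le> M \<le> j < N\<close>, it is always a
      dynamic one.\<close>
    proof (rule sum.reindex_bij_witness[where i = "\<lambda>t. t + (?N - 1 - r)" and j = "\<lambda>s. s - (?N - 1 - r)"])
      fix s assume s: "s \<in> {?N - 1 - r..j}"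
      have *: "M - (s - (?N - 1 - r)) = j - s" "r + s + 1 - ?N = s - (?N - 1 - r)"
        "s - (?N - 1 - r) < ?N" "\<not> r + s + 1 < ?N"
        using s r j False unfolding M_def by auto
      show "(\<Sum>i\<in>UNIV. \<Sum>k\<in>UNIV. coeff (Q $ i $ k) (M - (s - (?N - 1 - r))) *
          ((if b = i then coeff (?P $ k $ d) (s - (?N - 1 - r)) else 0)
            - (if k = d then coeff (?P $ b $ i) (s - (?N - 1 - r)) else 0)))
        = (\<Sum>i\<in>UNIV. \<Sum>k\<in>UNIV. coeff (Q $ i $ k) (j - s) * coord_bracket L r b d s k i)"
        unfolding coord_bracket_def *(1,2) coeff_Lpoly using *(3,4)
        by (intro sum.cong refl) simp
    qed (use r j False in \<open>auto simp: M_def\<close>)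
    also have "\<dots> = (\<Sum>t\<le>M. (\<Sum>k\<in>UNIV. coeff (?P $ k $ d) t * coeff (Q $ b $ k) (M - t))
        - (\<Sum>i\<in>UNIV. coeff (?P $ b $ i) t * coeff (Q $ i $ d) (M - t)))"
    proof (rule sum.cong[OF refl])
      fix t
      have "(\<Sum>i\<in>UNIV. \<Sum>k\<in>UNIV. coeff (Q $ i $ k) (M - t) * (if b = i then coeff (?P $ k $ d) t else 0))
          = (\<Sum>k\<in>UNIV. coeff (?P $ k $ d) t * coeff (Q $ b $ k) (M - t))"
        by (subst sum.swap) (simp add: if_distrib[of "\<lambda>x. _ * x"] mult.commute cong: if_cong)
      moreover have "(\<Sum>i\<in>UNIV. \<Sum>k\<in>UNIV. coeff (Q $ i $ k) (M - t) * (if k = d then coeff (?P $ b $ i) t else 0))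
          = (\<Sum>i\<in>UNIV. coeff (?P $ b $ i) t * coeff (Q $ i $ d) (M - t))"
        by (simp add: if_distrib[of "\<lambda>x. _ * x"] mult.commute cong: if_cong)
      ultimately show "(\<Sum>i\<in>UNIV. \<Sum>k\<in>UNIV.
        coeff (Q $ i $ k) (M - t) * ((if b = i then coeff (?P $ k $ d) t else 0)
          - (if k = d then coeff (?P $ b $ i) t else 0)))
        = (\<Sum>k\<in>UNIV. coeff (?P $ k $ d) t * coeff (Q $ b $ k) (M - t))
        - (\<Sum>i\<in>UNIV. coeff (?P $ b $ i) t * coeff (Q $ i $ d) (M - t))"
        by (simp only: right_diff_distrib sum_subtractf)
    qed
    also have "\<dots> = (\<Sum>k\<in>UNIV. coeff (?P $ k $ d * Q $ b $ k) M) - (\<Sum>i\<in>UNIV. coeff (?P $ b $ i * Q $ i $ d) M)"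
      unfolding sum_subtractf coeff_mult by (intro arg_cong2[of _ _ _ _ "(-)"] sum.swap)
    also have "\<dots> = coeff ((Q ** ?P) $ b $ d) M - coeff ((?P ** Q) $ b $ d) M"
      by (simp add: matrix_matrix_mult_def coeff_sum mult.commute)
    finally show ?thesis by (simp add: comm)
  qed
  have "casD Q j V = (\<Sum>i\<in>UNIV. \<Sum>k\<in>UNIV. \<Sum>s\<le>j. coeff (Q $ i $ k) (j - s) *
      (\<Sum>r<?N. \<Sum>b\<in>UNIV. \<Sum>d\<in>UNIV. a r b d * coord_bracket L r b d s k i))"
    unfolding casD_sum[OF j] using V j by (intro sum.cong refl) (simp add: hamiltonian_vector_def)
  also have "\<dots> = (\<Sum>i\<in>UNIV. \<Sum>k\<in>UNIV. \<Sum>s\<le>j. \<Sum>r<?N. \<Sum>b\<in>UNIV. \<Sum>d\<in>UNIV.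
      a r b d * (coeff (Q $ i $ k) (j - s) * coord_bracket L r b d s k i))"
    unfolding sum_distrib_left by (intro sum.cong refl) (simp only: mult_ac)
  also have "\<dots> = (\<Sum>r<?N. \<Sum>b\<in>UNIV. \<Sum>d\<in>UNIV. a r b d *
      (\<Sum>i\<in>UNIV. \<Sum>k\<in>UNIV. \<Sum>s\<le>j. coeff (Q $ i $ k) (j - s) * coord_bracket L r b d s k i))"
    unfolding sum_distrib_left by (rule sum3_swap3)
  also have "\<dots> = 0" by (simp add: Z)
  finally show ?thesis .
qed

lemma coeff_mult_has_derivative:
  fixes p p' q q' :: "'a::real_normed_vector \<Rightarrow> complex poly"
  assumes "\<And>n. ((\<lambda>t. coeff (p t) n) has_derivative (\<lambda>h. coeff (p' h) n)) (at t within S)"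
    and "\<And>n. ((\<lambda>t. coeff (q t) n) has_derivative (\<lambda>h. coeff (q' h) n)) (at t within S)"
  shows "((\<lambda>t. coeff (p t * q t) n) has_derivative (\<lambda>h. coeff (p' h * q t + p t * q' h) n)) (at t within S)"
  unfolding coeff_mult coeff_add
  by (rule derivative_eq_intros assms refl)+ (simp add: fun_eq_iff sum.distrib add.commute)

lemma matrix_mult_has_derivative:
  fixes P P' Q Q' :: "'a::real_normed_vector \<Rightarrow> complex poly^3^3"
  assumes "\<And>i j n. ((\<lambda>t. coeff (P t $ i $ j) n) has_derivative (\<lambda>h. coeff (P' h $ i $ j) n)) (at t within S)"
    and "\<And>i j n. ((\<lambda>t. coeff (Q t $ i $ j) n) has_derivative (\<lambda>h. coeff (Q' h $ i $ j) n)) (at t within S)"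
  shows "((\<lambda>t. coeff ((P t ** Q t) $ i $ j) n) has_derivative
    (\<lambda>h. coeff ((P' h ** Q t + P t ** Q' h) $ i $ j) n)) (at t within S)"
proof -
  have "((\<lambda>t. \<Sum>k\<in>UNIV. coeff (P t $ i $ k * Q t $ k $ j) n) has_derivative
    (\<lambda>h. \<Sum>k\<in>UNIV. coeff (P' h $ i $ k * Q t $ k $ j + P t $ i $ k * Q' h $ k $ j) n)) (at t within S)"
    by (intro has_derivative_sum coeff_mult_has_derivative assms)
  then show ?thesis by (simp add: matrix_matrix_mult_def coeff_sum sum.distrib)
qed

lemma trace_has_derivative:
  fixes P P' :: "'a::real_normed_vector \<Rightarrow> complex poly^3^3"
  assumes "\<And>i j n. ((\<lambda>t. coeff (P t $ i $ j) n) has_derivative (\<lambda>h. coeff (P' h $ i $ j) n)) (at t within S)"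
  shows "((\<lambda>t. coeff (trace (P t)) n) has_derivative (\<lambda>h. coeff (trace (P' h)) n)) (at t within S)"
  unfolding trace_def coeff_sum by (intro has_derivative_sum assms)

lemma Lpoly_has_derivative:
  "((\<lambda>L. coeff (Lpoly m q L $ i $ j) n) has_derivative (\<lambda>V. coeff (Vpoly V $ i $ j) n))
    (at (L :: complex^3^3^'n::enum) within S)"
  unfolding coeff_Lpoly coeff_Vpoly
  by (cases "n < CARD('n)") (auto intro: bounded_linear_imp_has_derivative bounded_linear_Lcoef)

lemma I2_has_derivative:
  "((\<lambda>L. coeff (I2 m q L) j) has_derivative casD (Lpoly m q L) j) (at (L :: complex^3^3^'n::enum) within S)"
proof -
  let ?P = "Lpoly m q L"
  have "((\<lambda>L. (1 / 2) * coeff (trace (Lpoly m q L ** Lpoly m q L)) j) has_derivative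
      (\<lambda>V. (1 / 2) * coeff (trace (Vpoly V ** ?P + ?P ** Vpoly V)) j)) (at L within S)"
    by (intro has_derivative_mult_right trace_has_derivative matrix_mult_has_derivative Lpoly_has_derivative)
  moreover have "(1 / 2) * coeff (trace (Vpoly V ** ?P + ?P ** Vpoly V)) j = casD ?P j V"
    for V :: "complex^3^3^'n::enum"
    by (simp only: trace_add coeff_add trace_mul_sym[of "Vpoly V"] casD_def) simp
  ultimately show ?thesis by (simp add: I2_def)
qed

lemma I3_has_derivative:
  "((\<lambda>L. coeff (I3 m q L) j) has_derivative casD (Lpoly m q L ** Lpoly m q L) j)
    (at (L :: complex^3^3^'n::enum) within S)"
proof -
  let ?P = "Lpoly m q L"
  have "((\<lambda>L. (1 / 3) * coeff (trace (Lpoly m q L ** Lpoly m q L ** Lpoly m q L)) j) has_derivative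
      (\<lambda>V. (1 / 3) * coeff (trace ((Vpoly V ** ?P + ?P ** Vpoly V) ** ?P + ?P ** ?P ** Vpoly V)) j)) (at L within S)"
    by (intro has_derivative_mult_right trace_has_derivative matrix_mult_has_derivative Lpoly_has_derivative)
  moreover have "(1 / 3) * coeff (trace ((Vpoly V ** ?P + ?P ** Vpoly V) ** ?P + ?P ** ?P ** Vpoly V)) j
      = casD (?P ** ?P) j V" for V :: "complex^3^3^'n::enum"
  proof -
    \<comment> \<open>By cyclicity the three terms of the product rule have equal trace, which
      cancels the factor 1/3.\<close>
    have "trace ((Vpoly V ** ?P) ** ?P) = trace (?P ** ?P ** Vpoly V)"
      by (metis matrix_mul_assoc trace_mul_sym)
    moreover have "trace ((?P ** Vpoly V) ** ?P) = trace (?P ** ?P ** Vpoly V)"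
      by (metis matrix_mul_assoc trace_mul_sym)
    moreover have "(Vpoly V ** ?P + ?P ** Vpoly V) ** ?P = (Vpoly V ** ?P) ** ?P + (?P ** Vpoly V) ** ?P"
      by (simp add: vec_eq_iff matrix_matrix_mult_def distrib_right sum.distrib)
    ultimately show ?thesis by (simp only: trace_add coeff_add casD_def) simp
  qed
  ultimately show ?thesis by (simp add: I3_def)
qed

lemma orbit_tangent_iff:
  assumes L: "(L :: complex^3^3^'n::enum) \<in> phase_space"
  shows "V \<in> orbit_tangent m q L \<longleftrightarrow> V \<in> phase_space \<and>
    (\<forall>j<CARD('n). casD (Lpoly m q L) j V = 0 \<and> casD (Lpoly m q L ** Lpoly m q L) j V = 0)"
  unfolding orbit_tangent_def
  using differential_eq[OF I2_has_derivative L] differential_eq[OF I3_has_derivative L] by auto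

section \<open>Reality of the Casimir differentials and the complexified tangent space\<close>

definition herm :: "complex poly^3^3 \<Rightarrow> bool" where
  "herm Q \<longleftrightarrow> (\<forall>i k s. coeff (Q $ i $ k) s = cnj (coeff (Q $ k $ i) s))"

lemma herm_Lpoly:
  assumes "(L :: complex^3^3^'n::enum) \<in> phase_space"
  shows "herm (Lpoly m q L)"
proof -
  have "cnj (Lcoef L p $ k $ i) = Lcoef L p $ i $ k" for p i k
    using assms unfolding phase_space_def Lcoef_def by (metis (mono_tags, lifting) mem_Collect_eq)
  moreover have "\<forall>i k. cnj (lead_coef m q $ k $ i) = lead_coef m q $ i $ k"
    by (simp add: forall_3 lead_coef_eq vector_3)
  ultimately show ?thesis unfolding herm_def coeff_Lpoly by simp
qed

lemma herm_square: assumes "herm Q" shows "herm (Q ** Q)"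
  unfolding herm_def
proof (intro allI)
  fix i k s
  have q: "cnj (coeff (Q $ i $ k) s) = coeff (Q $ k $ i) s" for i k s
    using assms unfolding herm_def by metis
  have "cnj (coeff ((Q ** Q) $ k $ i) s) = (\<Sum>l\<in>UNIV. \<Sum>b\<le>s. coeff (Q $ l $ k) b * coeff (Q $ i $ l) (s - b))"
    by (simp add: matrix_matrix_mult_def coeff_sum coeff_mult q)
  also have "\<dots> = (\<Sum>l\<in>UNIV. coeff (Q $ l $ k * Q $ i $ l) s)"
    by (simp add: coeff_mult)
  also have "\<dots> = coeff ((Q ** Q) $ i $ k) s"
    by (simp add: matrix_matrix_mult_def coeff_sum mult.commute)
  finally show "coeff ((Q ** Q) $ i $ k) s = cnj (coeff ((Q ** Q) $ k $ i) s)" by simp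
qed

text \<open>The trace of a product of two Hermitian matrices is real. This lets one complex Casimir
  condition split into conditions on the two Hermitian parts of a Hamiltonian vector.\<close>

lemma casD_real:
  assumes Q: "herm Q" and j: "j < CARD('n)" and V: "(V :: complex^3^3^'n::enum) \<in> phase_space"
  shows "Im (casD Q j V) = 0"
proof -
  have v: "cnj (Lcoef V p $ k $ i) = Lcoef V p $ i $ k" for p i k
    using V unfolding phase_space_def Lcoef_def by (metis (mono_tags, lifting) mem_Collect_eq)
  have q: "cnj (coeff (Q $ i $ k) s) = coeff (Q $ k $ i) s" for i k s
    using Q unfolding herm_def by metis
  have "cnj (casD Q j V) = (\<Sum>i\<in>UNIV. \<Sum>k\<in>UNIV. \<Sum>s\<le>j. coeff (Q $ k $ i) (j - s) * Lcoef V s $ i $ k)"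
    unfolding casD_sum[OF j] by (simp add: v q)
  also have "\<dots> = casD Q j V"
    unfolding casD_sum[OF j] by (rule sum.swap)
  finally show ?thesis by (metis complex_cnj_cancel_iff Reals_cnj_iff complex_is_Real_iff)
qed

lemma hermitian_decomposition:
  assumes "\<And>p. trace (V $ p) = 0"
  obtains X Y where "X \<in> phase_space" "Y \<in> phase_space" "V = X + cscale \<i> (Y :: complex^3^3^'n::enum)"
proof
  let ?X = "(\<chi> p i j. (V $ p $ i $ j + cnj (V $ p $ j $ i)) / 2) :: complex^3^3^'n::enum"
  let ?Y = "(\<chi> p i j. (V $ p $ i $ j - cnj (V $ p $ j $ i)) / (2 * \<i>)) :: complex^3^3^'n::enum"
  have t: "(\<Sum>i\<in>UNIV. V $ p $ i $ i) = 0" for p using assms by (simp add: trace_def)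
  then have t': "(\<Sum>i\<in>UNIV. cnj (V $ p $ i $ i)) = 0" for p by (simp flip: cnj_sum)
  show "?X \<in> phase_space"
    by (auto simp: phase_space_def trace_def t t' sum.distrib add.commute simp flip: sum_divide_distrib)
  show "?Y \<in> phase_space"
    by (auto simp: phase_space_def trace_def t t' sum_subtractf field_simps simp flip: sum_divide_distrib)
  show "V = ?X + cscale \<i> ?Y"
    by (simp add: vec_eq_iff cscale_def field_simps)
qed

text \<open>Hamiltonian vectors of complex covectors lie in the complexified tangent space of the orbit.\<close>

lemma hamiltonian_vector_orbit_tangent:
  assumes L: "(L :: complex^3^3^'n::enum) \<in> phase_space" and V: "hamiltonian_vector L a V"
  obtains X Y where "X \<in> orbit_tangent m q L" "Y \<in> orbit_tangent m q L" "V = X + cscale \<i> Y"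
proof -
  obtain X Y where XY: "X \<in> phase_space" "Y \<in> phase_space" "V = X + cscale \<i> Y"
    using hermitian_decomposition[OF trace_hamiltonian[OF V]] by blast
  have z: "casD Q j X = 0 \<and> casD Q j Y = 0"
    if "herm Q" "Q ** Lpoly m q L = Lpoly m q L ** Q" "j < CARD('n)" for Q j
  proof -
    have "casD Q j X + \<i> * casD Q j Y = 0"
      using casD_hamiltonian[OF that(2,3) V] casD_linear(1)[OF that(3)] XY(3) by metis
    then show ?thesis
      using casD_real[OF that(1,3)] XY(1,2) by (simp add: complex_eq_iff)
  qed
  have "X \<in> orbit_tangent m q L \<and> Y \<in> orbit_tangent m q L"
    unfolding orbit_tangent_iff[OF L]
    using z[OF herm_Lpoly[OF L]] z[OF herm_square[OF herm_Lpoly[OF L]]] XY(1,2)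
    by (simp add: matrix_mul_assoc)
  then show ?thesis using that XY(3) by blast
qed

text \<open>Applying \<open>f i\<close> to a vanishing combination isolates the coefficient of
  \<open>e i\<close>.\<close>

lemma independent_biorthogonal:
  fixes e :: "'i \<Rightarrow> 'a::real_vector" and f :: "'i \<Rightarrow> 'a \<Rightarrow> real"
  assumes I: "finite I" and f: "\<And>i. i \<in> I \<Longrightarrow> linear (f i)"
    and fe: "\<And>i j. i \<in> I \<Longrightarrow> j \<in> I \<Longrightarrow> f i (e j) = (if i = j then 1 else 0)"
  shows "independent (e ` I)" and "card (e ` I) = card I"
proof -
  have inj: "inj_on e I" using fe by (metis inj_onI zero_neq_one)
  then show "card (e ` I) = card I" by (rule card_image)
  show "independent (e ` I)"
  proof (rule independent_if_scalars_zero)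
    fix c x assume z: "(\<Sum>x\<in>e ` I. c x *\<^sub>R x) = 0" and "x \<in> e ` I"
    then obtain i where i: "i \<in> I" "x = e i" by auto
    have "(\<Sum>j\<in>I. c (e j) *\<^sub>R e j) = 0" using z by (simp add: sum.reindex[OF inj])
    then have "0 = f i (\<Sum>j\<in>I. c (e j) *\<^sub>R e j)" using linear_0[OF f[OF i(1)]] by simp
    also have "\<dots> = (\<Sum>j\<in>I. c (e j) * f i (e j))"
      using f[OF i(1)] by (simp add: linear_sum linear_cmul)
    also have "\<dots> = (\<Sum>j\<in>I. if i = j then c (e j) else 0)"
      using fe i(1) by (intro sum.cong) auto
    finally show "c x = 0" using i I by simp
  qed (use I in simp)
qed

lemma subspace_orbit_tangent:
  assumes L: "(L :: complex^3^3^'n::enum) \<in> phase_space"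
  shows "subspace (orbit_tangent m q L)"
proof (rule subspaceI)
  have 0: "(0 :: complex^3^3^'n::enum) \<in> phase_space" by (simp add: phase_space_def trace_def)
  then show "0 \<in> orbit_tangent m q L" by (simp add: orbit_tangent_iff[OF L] casD_linear)
  fix u v c assume u: "u \<in> orbit_tangent m q L" and v: "v \<in> orbit_tangent m q L"
  have *: "x + cscale (of_real r) y \<in> orbit_tangent m q L"
    if "x \<in> orbit_tangent m q L" "y \<in> orbit_tangent m q L" for x y r
    using that phase_space_affine[of x y r]
    by (simp add: orbit_tangent_iff[OF L] casD_linear scaleR_eq_cscale)
  show "u + v \<in> orbit_tangent m q L"
    using *[OF u v, of 1] by (simp only: scaleR_eq_cscale[symmetric] scaleR_one)
  show "c *\<^sub>R u \<in> orbit_tangent m q L" for c :: real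
    using *[OF \<open>0 \<in> orbit_tangent m q L\<close> u, of c] by (simp flip: scaleR_eq_cscale)
qed

lemma linear_cscale: "linear (cscale c :: complex^3^3^'n::enum \<Rightarrow> _)"
  by (rule linearI) (simp_all add: cscale_def vec_eq_iff algebra_simps)

lemma dim_complexification_le:
  assumes "subspace (T :: (complex^3^3^'n::enum) set)"
  shows "dim {x + y | x y. x \<in> T \<and> y \<in> cscale \<i> ` T} \<le> 2 * dim T"
proof -
  have "dim (cscale \<i> ` T) \<le> dim T" by (rule dim_image_le[OF linear_cscale])
  then show ?thesis
    using dim_sums_Int[OF assms linear_subspace_image[OF linear_cscale assms, of \<i>]] by linarith
qed

text \<open>Linearity is reduced to that of \<open>covector\<close>: up to sign, pairing with
  \<open>c\<close> is evaluation on the Hamiltonian vector of \<open>c\<close>.\<close>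

lemma bivector_comb:
  fixes L :: "complex^3^3^'n::enum"
  shows "bivector L (\<lambda>r i j. \<Sum>k\<in>A. x k * a k r i j + y k * b k r i j) c
    = (\<Sum>k\<in>A. x k * bivector L (a k) c + y k * bivector L (b k) c)"
proof -
  obtain V where V: "hamiltonian_vector L c V" using ex_hamiltonian_vector by blast
  have "covector (\<lambda>r i j. \<Sum>k\<in>A. x k * a k r i j + y k * b k r i j) V
      = (\<Sum>r<CARD('n). \<Sum>i\<in>UNIV. \<Sum>j\<in>UNIV. \<Sum>k\<in>A.
        x k * (a k r i j * Lcoef V r $ i $ j) + y k * (b k r i j * Lcoef V r $ i $ j))"
    unfolding covector_def sum_distrib_right by (simp add: algebra_simps)
  also have "\<dots> = (\<Sum>k\<in>A. x k * covector (a k) V + y k * covector (b k) V)"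
    unfolding covector_def sum_distrib_left sum.distrib[symmetric] by (rule sum_swap3[symmetric])
  finally have "- bivector L (\<lambda>r i j. \<Sum>k\<in>A. x k * a k r i j + y k * b k r i j) c
      = - (\<Sum>k\<in>A. x k * bivector L (a k) c + y k * bivector L (b k) c)"
    unfolding covector_hamiltonian[OF V] bivector_antisym[of L c] by (simp flip: sum_negf)
  then show ?thesis by (simp only: neg_equal_iff_equal)
qed

section \<open>Tangent vectors and the symplectic form in the separation variables\<close>

context separation
begin

definition comb :: "complex^3^3^'n::enum \<Rightarrow> (nat \<Rightarrow> complex) \<Rightarrow> (nat \<Rightarrow> complex) \<Rightarrow> nat \<Rightarrow> 3 \<Rightarrow> 3 \<Rightarrow> complex" where
  "comb L x y r i j = (\<Sum>k<3 * CARD('n).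
     x k * ecov (lam k L) (alpha k L) r i j + y k * ecov (lam k L) (omega k L) r i j)"

lemma bivector_comb_left:
  "bivector L (comb L x y) c = (\<Sum>k<3 * CARD('n).
     x k * bivector L (ecov (lam k L) (alpha k L)) c + y k * bivector L (ecov (lam k L) (omega k L)) c)"
  unfolding comb_def[abs_def] by (rule bivector_comb)

text \<open>The quasi-canonical brackets allow the coefficients to be read off: the differential of
  \<open>w l\<close> moves only \<open>lam l\<close>, and that of \<open>lam l\<close> only
  \<open>w l\<close>.\<close>

lemma
  assumes L: "L \<in> U" and V: "hamiltonian_vector L (comb L x y) V" and l: "l < 3 * CARD('n)"
  shows dlam_comb: "dlam l L V = y l * lam l L ^ CARD('n)"
    and dw_comb: "dw l L V = - x l * lam l L ^ CARD('n)"
proof -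
  have w_lam: "bivector L (ecov (lam k L) (omega k L)) (ecov (lam l L) (alpha l L))
      = (if k = l then lam l L ^ CARD('n) else 0)" if "k < 3 * CARD('n)" for k
    using bivector_lam_w[OF L l that] bivector_antisym[of L "ecov (lam k L) (omega k L)" "ecov (lam l L) (alpha l L)"]
    by auto
  have "dlam l L V = bivector L (comb L x y) (ecov (lam l L) (alpha l L))"
    using covector_hamiltonian[OF V] covector_alpha[OF L l] by metis
  also have "\<dots> = (\<Sum>k<3 * CARD('n). if k = l then y l * lam l L ^ CARD('n) else 0)"
    unfolding bivector_comb_left
    by (intro sum.cong) (auto simp: bivector_lam_lam[OF L _ l] w_lam)
  finally show "dlam l L V = y l * lam l L ^ CARD('n)" using l by simp
  have "dw l L V = bivector L (comb L x y) (ecov (lam l L) (omega l L))"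
    using covector_hamiltonian[OF V] covector_omega[OF L l] by metis
  also have "\<dots> = (\<Sum>k<3 * CARD('n). if k = l then - x l * lam l L ^ CARD('n) else 0)"
    unfolding bivector_comb_left
    by (intro sum.cong) (auto simp: bivector_lam_w[OF L _ l] bivector_w_w[OF L _ l])
  finally show "dw l L V = - x l * lam l L ^ CARD('n)" using l by simp
qed

lemma symplectic_form_comb:
  assumes L: "L \<in> U" and nz: "\<forall>k<3 * CARD('n). lam k L \<noteq> 0"
    and u: "hamiltonian_vector L (comb L x y) u" and v: "hamiltonian_vector L b v"
  shows "symplectic_form L u v =
    - (\<Sum>k<3 * CARD('n). inverse (lam k L ^ CARD('n)) * (dw k L u * dlam k L v - dw k L v * dlam k L u))"
proof -
  define a' b' where "a' = (SOME a. hamiltonian_vector L a u)" and "b' = (SOME b. hamiltonian_vector L b v)"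
  have a': "hamiltonian_vector L a' u" and b': "hamiltonian_vector L b' v"
    unfolding a'_def b'_def using u v by (metis someI)+
  have "symplectic_form L u v = - bivector L a' b'"
    by (simp add: symplectic_form_def a'_def b'_def)
  \<comment> \<open>The chosen \<open>a'\<close> may differ from the combination, but both have the
    Hamiltonian vector \<open>u\<close> and so the same bracket with \<open>b'\<close>.\<close>
  also have "bivector L a' b' = bivector L (comb L x y) b'"
    using covector_hamiltonian[OF a'] covector_hamiltonian[OF u] by metis
  also have "\<dots> = (\<Sum>k<3 * CARD('n).
      inverse (lam k L ^ CARD('n)) * (dw k L u * dlam k L v - dw k L v * dlam k L u))"
    unfolding bivector_comb_left
  proof (intro sum.cong refl)
    fix k assume "k \<in> {..<3 * CARD('n)}"
    then have k: "k < 3 * CARD('n)" by simp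
    have "bivector L c b' = - covector c v" for c
      using covector_hamiltonian[OF b'] bivector_antisym by metis
    then have "bivector L (ecov (lam k L) (alpha k L)) b' = - dlam k L v"
      "bivector L (ecov (lam k L) (omega k L)) b' = - dw k L v"
      by (simp_all add: covector_alpha[OF L k] covector_omega[OF L k])
    then show "x k * bivector L (ecov (lam k L) (alpha k L)) b' + y k * bivector L (ecov (lam k L) (omega k L)) b'
      = inverse (lam k L ^ CARD('n)) * (dw k L u * dlam k L v - dw k L v * dlam k L u)"
      using nz k by (simp add: dlam_comb[OF L u k] dw_comb[OF L u k] field_simps)
  qed
  finally show ?thesis .
qed

lemma subspace_comb: "subspace {V. \<exists>x y. hamiltonian_vector L (comb L x y) V}"
proof -
  have *: "\<exists>x'' y''. hamiltonian_vector L (comb L x'' y'') (V + cscale c W)"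
    if "hamiltonian_vector L (comb L x y) V" "hamiltonian_vector L (comb L x' y') W" for V W x y x' y' c
  proof -
    have "comb L (\<lambda>k. x k + c * x' k) (\<lambda>k. y k + c * y' k)
        = (\<lambda>r i j. comb L x y r i j + c * comb L x' y' r i j)"
      by (simp add: fun_eq_iff comb_def sum.distrib sum_distrib_left algebra_simps)
    then show ?thesis
      using hamiltonian_vector_add[OF that(1) hamiltonian_vector_cscale[OF that(2)], of c] by metis
  qed
  have 0: "hamiltonian_vector L (comb L (\<lambda>_. 0) (\<lambda>_. 0)) 0"
    by (simp add: hamiltonian_vector_def comb_def)
  show ?thesis
  proof (rule subspaceI, unfold mem_Collect_eq)
    show "\<exists>x y. hamiltonian_vector L (comb L x y) 0" using 0 by blast
  next
    fix V W
    assume "\<exists>x y. hamiltonian_vector L (comb L x y) V" "\<exists>x y. hamiltonian_vector L (comb L x y) W"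
    then show "\<exists>x y. hamiltonian_vector L (comb L x y) (V + W)"
      using *[where c = "of_real 1"] by (metis scaleR_eq_cscale scaleR_one)
  next
    fix r :: real and V
    assume "\<exists>x y. hamiltonian_vector L (comb L x y) V"
    then show "\<exists>x y. hamiltonian_vector L (comb L x y) (r *\<^sub>R V)"
      using *[OF 0, where c = "of_real r"] by (metis scaleR_eq_cscale add_0)
  qed
qed

lemma linear_dlam_dw:
  assumes "L \<in> U" "k < 3 * CARD('n)"
  shows "linear (dlam k L)" "linear (dw k L)"
  using has_derivative_linear lam_has_derivative[OF assms] w_has_derivative[OF assms] by blast+

text \<open>
  Since the brackets of the \<open>lam\<close> and \<open>w\<close> form a nondegenerate matrix, the Hamiltonian vectors of
  their differentials and \<open>\<i>\<close> times these are \<open>12 N\<close> real-independent vectors in the complexified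
  tangent space, whose real dimension is at most \<open>12 N\<close>; so they span it.
\<close>

lemma orbit_tangent_comb:
  assumes L: "L \<in> U" and nz: "\<forall>k<3 * CARD('n). lam k L \<noteq> 0"
    and dim: "dim (orbit_tangent m q L) = 6 * CARD('n)" and u: "u \<in> orbit_tangent m q L"
  obtains x y where "hamiltonian_vector L (comb L x y) u"
proof -
  let ?T = "orbit_tangent m q L" and ?W = "{V. \<exists>x y. hamiltonian_vector L (comb L x y) V}"
  let ?TC = "{x + y | x y. x \<in> ?T \<and> y \<in> cscale \<i> ` ?T}"
  note LP = U_phase_space[OF L]
  \<comment> \<open>In \<open>(k, s, t)\<close>, \<open>s\<close> selects the differential of
    \<open>w k\<close> or of \<open>lam k\<close>, and \<open>t\<close> multiplies it by \<i>; this
    makes \<open>12 * CARD('n)\<close> covectors.\<close>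
  define I where "I = {..<3 * CARD('n)} \<times> (UNIV :: bool set) \<times> (UNIV :: bool set)"
  define \<delta> :: "nat \<Rightarrow> complex \<Rightarrow> nat \<Rightarrow> complex" where "\<delta> k c = (\<lambda>l. if l = k then c else 0)" for k c
  define cov where "cov = (\<lambda>(k, s, t). let c = if t then \<i> else 1 in
      if s then comb L (\<lambda>_. 0) (\<delta> k c) else comb L (\<delta> k c) (\<lambda>_. 0))"
  define e where "e i = (SOME V. hamiltonian_vector L (cov i) V)" for i
  have e: "hamiltonian_vector L (cov i) (e i)" for i
    unfolding e_def using ex_hamiltonian_vector by (rule someI_ex)
  \<comment> \<open>Complex coordinates dual to the Hamiltonian vectors, normalized by the values of
    \<open>dlam\<close> and \<open>dw\<close> on them; \<open>f\<close> takes real and imaginary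
    parts to obtain real linear forms.\<close>
  define g where "g = (\<lambda>(k, s, t :: bool) V. if s then dlam k L V / lam k L ^ CARD('n)
      else - dw k L V / lam k L ^ CARD('n))"
  define f where "f = (\<lambda>(k, s, t) V. if t then Im (g (k, s, t) V) else Re (g (k, s, t) V))"
  have fe: "f i (e j) = (if i = j then 1 else 0)" if "i \<in> I" "j \<in> I" for i j
  proof -
    obtain k s t l s' t' where ij: "i = (k, s, t)" "j = (l, s', t')" by (metis prod_cases3)
    have k: "k < 3 * CARD('n)" using that ij by (simp add: I_def)
    have H: "hamiltonian_vector L (cov j) (e j)" by (rule e)
    have "g i (e j) = (if k = l \<and> s = s' then if t' then \<i> else 1 else 0)"
    proof (cases s')
      case True
      then have "hamiltonian_vector L (comb L (\<lambda>_. 0) (\<delta> l (if t' then \<i> else 1))) (e j)"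
        using H by (simp add: cov_def ij Let_def)
      from dlam_comb[OF L this k] dw_comb[OF L this k] show ?thesis
        using True nz k by (cases "k = l") (simp_all add: g_def ij \<delta>_def)
    next
      case False
      then have "hamiltonian_vector L (comb L (\<delta> l (if t' then \<i> else 1)) (\<lambda>_. 0)) (e j)"
        using H by (simp add: cov_def ij Let_def)
      from dlam_comb[OF L this k] dw_comb[OF L this k] show ?thesis
        using False nz k by (cases "k = l") (simp_all add: g_def ij \<delta>_def)
    qed
    then show ?thesis by (auto simp: f_def ij)
  qed
  have lin: "linear (f i)" if "i \<in> I" for i
  proof -
    obtain k s t where i: "i = (k, s, t)" by (metis prod_cases3)
    have k: "k < 3 * CARD('n)" using that i by (simp add: I_def)
    note l = linear_dlam_dw[OF L k]
    have scaleR_divide: "(r *\<^sub>R z) / c = r *\<^sub>R (z / c)" for r and z c :: complex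
      by (simp add: scaleR_conv_of_real)
    show ?thesis
      unfolding i
      by (rule linearI) (simp_all add: f_def g_def linear_add[OF l(1)] linear_add[OF l(2)]
          linear_cmul[OF l(1)] linear_cmul[OF l(2)] add_divide_distrib diff_divide_distrib
          scaleR_divide)
  qed
  have fin: "finite I" by (simp add: I_def)
  note indep = independent_biorthogonal[OF fin lin fe]
  have card: "card (e ` I) = 12 * CARD('n)" using indep(2) by (simp add: I_def)
  have eT: "e ` I \<subseteq> ?TC"
  proof (rule image_subsetI)
    fix i
    show "e i \<in> ?TC" using hamiltonian_vector_orbit_tangent[OF LP e, of m q i] by blast
  qed
  have "dim ?TC \<le> card (e ` I)"
    using dim_complexification_le[OF subspace_orbit_tangent[OF LP, of m q]] dim card by simp
  then have "?TC \<subseteq> span (e ` I)"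
    using card_ge_dim_independent[OF eT indep(1)] by simp
  moreover have "u \<in> ?TC"
  proof -
    have "0 \<in> ?T" using subspace_0[OF subspace_orbit_tangent[OF LP]] .
    then have "cscale \<i> 0 \<in> cscale \<i> ` ?T" by blast
    then have "0 \<in> cscale \<i> ` ?T" by (simp add: linear_0[OF linear_cscale])
    then show ?thesis using u by force
  qed
  moreover have "span (e ` I) \<subseteq> ?W"
  proof (rule span_minimal[OF _ subspace_comb], rule image_subsetI)
    fix i :: "nat \<times> bool \<times> bool"
    obtain k s t where "i = (k, s, t)" by (metis prod_cases3)
    then show "e i \<in> ?W" using e[of i] by (auto simp: cov_def Let_def split: if_splits)
  qed
  ultimately show ?thesis using that by blast
qed

lemma liouville:
  assumes "generic_orbit m q S"
  shows "liouville_form m q {L \<in> S \<inter> U. \<forall>k<3 * CARD('n). lam k L \<noteq> 0} (Omega lam w)"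
  unfolding liouville_form_def
proof (intro ballI conjI)
  fix L assume "L \<in> {L \<in> S \<inter> U. \<forall>k<3 * CARD('n). lam k L \<noteq> 0}"
  then have L: "L \<in> U" and nz: "\<forall>k<3 * CARD('n). lam k L \<noteq> 0" and S: "L \<in> S" by auto
  have dim: "dim (orbit_tangent m q L) = 6 * CARD('n)"
    using assms S by (simp add: generic_orbit_def)
  show "(\<lambda>L'. Omega lam w L' v) differentiable at L within phase_space" if "v \<in> phase_space" for v
    using Omega_has_derivative[OF L nz that] by (rule differentiableI)
  fix u v assume u: "u \<in> orbit_tangent m q L" and v: "v \<in> orbit_tangent m q L"
  then have p: "u \<in> phase_space" "v \<in> phase_space" by (simp_all add: orbit_tangent_def)
  obtain x y x' y' where "hamiltonian_vector L (comb L x y) u" "hamiltonian_vector L (comb L x' y') v"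
    using orbit_tangent_comb[OF L nz dim u] orbit_tangent_comb[OF L nz dim v] by metis
  then show "ext_deriv (Omega lam w) L u v = symplectic_form L u v"
    by (simp only: symplectic_form_comb[OF L nz] ext_deriv_Omega[OF L nz p])
qed

end

theorem mainTheorem1:
  fixes m q :: real
    and U :: "(complex^3^3^'n::enum) set"
    and lam w :: "nat \<Rightarrow> complex^3^3^'n::enum \<Rightarrow> complex"
  assumes lead: "m \<noteq> 0" "m \<noteq> 3 * q" "m \<noteq> - 3 * q"
    and sep: "separation_variables m q U lam w"
  shows
    "(\<forall>L\<in>U. degree (Bpoly m q L) = 3 * CARD('n) \<and>
        (\<forall>k<3 * CARD('n). Afun m q L (lam k L) = Afun' m q L (lam k L)))
   \<and> (\<forall>L\<in>U. \<forall>k<3 * CARD('n).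
        (w k L, lam k L) \<in> spectral_curve m q L \<and>
        w k L ^ 3 - w k L * poly (I2 m q L) (lam k L) - poly (I3 m q L) (lam k L) = 0)
   \<and> (\<forall>L\<in>U. \<forall>k<3 * CARD('n).
        lam k differentiable (at L within phase_space) \<and>
        w k differentiable (at L within phase_space) \<and>
        (\<forall>l<3 * CARD('n).
           poisson (lam k) (lam l) L = 0 \<and>
           poisson (lam k) (w l) L = - (lam k L ^ CARD('n)) * (if k = l then 1 else 0) \<and>
           poisson (w k) (w l) L = 0))
   \<and> (\<forall>S. generic_orbit m q S \<longrightarrow>
        liouville_form m q {L \<in> S \<inter> U. \<forall>k<3 * CARD('n). lam k L \<noteq> 0} (Omega lam w))"
proof -
  interpret separation m q U lam w using lead sep by unfold_locales
  have poisson: "poisson (lam k) (lam l) L = 0 \<and>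
      poisson (lam k) (w l) L = - (lam k L ^ CARD('n)) * (if k = l then 1 else 0) \<and>
      poisson (w k) (w l) L = 0"
    if L: "L \<in> U" and k: "k < 3 * CARD('n)" and l: "l < 3 * CARD('n)" for L k l
    by (simp only: poisson_eq_bivector[OF has_differential_lam[OF L k] has_differential_lam[OF L l] U_phase_space[OF L]]
        poisson_eq_bivector[OF has_differential_lam[OF L k] has_differential_w[OF L l] U_phase_space[OF L]]
        poisson_eq_bivector[OF has_differential_w[OF L k] has_differential_w[OF L l] U_phase_space[OF L]]
        bivector_lam_lam[OF L k l] bivector_lam_w[OF L k l] bivector_w_w[OF L k l] simp_thms)
  show ?thesis
    using degree_Bpoly[OF lead] Afun_eq_Afun' spectral poisson liouville
      differentiableI[OF lam_has_derivative] differentiableI[OF w_has_derivative] by blast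
qed

end
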